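(* Let $\mathsf{M},\mathsf{N}$ be model categories and let $F:\mathsf{M}\to\mathsf{N}$ be a functor that sends weak equivalences between cofibrant objects to weak equivalences. Let $\tilde C$ be a local cofibrant F-replacement and $Q$ a cofibrant F-replacement functor of $\mathsf{M}$. Then the Kan extension derived functor $\mathbb{L}^KF:\mathsf{Ho}(\mathsf{M})\to\mathsf{Ho}(\mathsf{N})$, i.e. the right Kan extension of $\gamma_{\mathsf N}\circ F$ along $\gamma_{\mathsf M}$, exists and is given by $\mathrm{Ho}(F\circ\tilde C)$ and by $\mathbb{L}^S_QF=\mathrm{Ho}(F\circ Q)$. This means that (up to the identification of canonically isomorphic functors) $$\mathbb{L}^KF=\mathrm{Ho}(F\circ\tilde C)=\mathbb{L}^S_QF=\mathrm{Ho}(F\circ Q)$$ and implies that $$\mathbb{L}^KF\circ\gamma_{\mathsf M}=\gamma_{\mathsf N}\circ F\circ\tilde C=\mathbb{L}^S_QF\circ\gamma_{\mathsf M}=\gamma_{\mathsf N}\circ F\circ Q.$$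
   Context: All model categories are assumed to admit functorial factorizations. Convention: objects connected by a unique or canonical isomorphism are identified; in particular, a Kan extension "is given by" a functor if that functor, equipped with a suitable natural transformation, is a universal pair in the sense below, and distinct universal pairs are identified via the unique comparison isomorphism. Quillen homotopy category: $\gamma_{\mathsf M}:\mathsf{M}\to\mathsf{Ho}(\mathsf{M})$ is the strong localization of $\mathsf{M}$ at its weak equivalences: $\gamma_{\mathsf M}$ sends weak equivalences to isomorphisms, and every functor $G:\mathsf{M}\to\mathsf{D}$ sending weak equivalences to isomorphisms factors as $G=\mathrm{Ho}(G)\circ\gamma_{\mathsf M}$ (strict equality) for a unique functor $\mathrm{Ho}(G):\mathsf{Ho}(\mathsf{M})\to\mathsf{D}$. It exists, with the same objects as $\mathsf{M}$ and $\gamma_{\mathsf M}X=X$. Similarly, $\gamma_{\mathsf M_c}:\mathsf{M}_c\to\mathsf{Ho}(\mathsf{M}_c)$ is the strong localization of the full subcategory $i:\mathsf{M}_c\hookrightarrow\mathsf{M}$ of cofibrant objects at the weak equivalences between them. Cofibrant F-replacement functor $Q$: the functor obtained from a functorial factorization $0\to QX\xrightarrow{q_X}X$ into a cofibration followed by a trivial fibration; $q$ is natural. $Q$ is viewed as a functor $\mathsf{M}\to\mathsf{M}_c$ or as an endofunctor of $\mathsf{M}$ (i.e. $i\circ Q$), as appropriate. Local cofibrant F-replacement $\tilde C$: for every object $X$ a chosen factorization $0\to\tilde C X\xrightarrow{c_X}X$ into a cofibration followed by a trivial fibration, with $c_X=\mathrm{id}_X$ if $X$ is cofibrant; for $f:X\to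 Y$, $\tilde C f$ is any lift with $c_Y\circ\tilde C f=f\circ c_X$ (well defined only up to left homotopy). Under the hypothesis on $F$, the assignment $\gamma_{\mathsf N}\circ F\circ\tilde C$ ($X\mapsto F(\tilde CX)$, $f\mapsto\gamma_{\mathsf N}(F(\tilde C f))$) is a well-defined functor $\mathsf{M}\to\mathsf{Ho}(\mathsf{N})$ sending weak equivalences to isomorphisms, as is $\gamma_{\mathsf N}\circ F\circ Q$. $\mathrm{Ho}(F\circ\tilde C)$ and $\mathrm{Ho}(F\circ Q)$ denote the unique functors $\mathsf{Ho}(\mathsf{M})\to\mathsf{Ho}(\mathsf{N})$ with $\mathrm{Ho}(F\circ\tilde C)\circ\gamma_{\mathsf M}=\gamma_{\mathsf N}\circ F\circ\tilde C$ and $\mathrm{Ho}(F\circ Q)\circ\gamma_{\mathsf M}=\gamma_{\mathsf N}\circ F\circ Q$. S derived functor: $\mathbb{L}^S_QF:=\mathrm{Ho}(F)\circ\mathrm{Ho}(Q)$, where $\mathrm{Ho}(F):\mathsf{Ho}(\mathsf{M}_c)\to\mathsf{Ho}(\mathsf{N})$ is the unique functor with $\mathrm{Ho}(F)\circ\gamma_{\mathsf M_c}=\gamma_{\mathsf N}\circ F\circ i$ and $\mathrm{Ho}(Q):\mathsf{Ho}(\mathsf{M})\to\mathsf{Ho}(\mathsf{M}_c)$ the unique functor with $\mathrm{Ho}(Q)\circ\gamma_{\mathsf M}=\gamma_{\mathsf M_c}\circ Q$. Right Kan extension of $G:\mathsf{C}\to\mathsf{D}$ along $P:\mathsf{C}\to\mathsf{C}'$: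 a functor $P_*G:\mathsf{C}'\to\mathsf{D}$ with a natural transformation $\varepsilon:P_*G\circ P\Rightarrow G$ such that for every $H:\mathsf{C}'\to\mathsf{D}$ and natural transformation $\eta:H\circ P\Rightarrow G$ there is a unique natural transformation $\kappa:H\Rightarrow P_*G$ with $\eta=\varepsilon\circ(\kappa\star P)$, $\star$ denoting whiskering. *)

theory Defs
  imports "HOL-Library.FuncSet"
begin

section \<open>Categories, functors, natural transformations\<close>

record ('o, 'm) cat =
  Obj :: "'o set"
  Arr :: "'m set"
  Dom :: "'m \<Rightarrow> 'o"
  Cod :: "'m \<Rightarrow> 'o"
  Ident :: "'o \<Rightarrow> 'm"
  Comp :: "'m \<Rightarrow> 'm \<Rightarrow> 'm" (infixr "\<cdot>\<index>" 70)

definition hom :: "('o, 'm, 'x) cat_scheme \<Rightarrow> 'o \<Rightarrow> 'o \<Rightarrow> 'm set" where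
  "hom C x y = {f \<in> Arr C. Dom C f = x \<and> Cod C f = y}"

text \<open>Only the values of the operations on objects and on (composable) arrows matter.\<close>

locale category =
  fixes C :: "('o, 'm, 'x) cat_scheme" (structure)
  assumes dom_obj: "f \<in> Arr C \<Longrightarrow> Dom C f \<in> Obj C"
    and cod_obj: "f \<in> Arr C \<Longrightarrow> Cod C f \<in> Obj C"
    and ident_hom: "x \<in> Obj C \<Longrightarrow> Ident C x \<in> hom C x x"
    and comp_hom: "f \<in> hom C x y \<Longrightarrow> g \<in> hom C y z \<Longrightarrow> g \<cdot> f \<in> hom C x z"
    and ident_left: "f \<in> hom C x y \<Longrightarrow> Ident C y \<cdot> f = f"
    and ident_right: "f \<in> hom C x y \<Longrightarrow> f \<cdot> Ident C x = f"
    and comp_assoc: "f \<in> hom C w x \<Longrightarrow> g \<in> hom C x y \<Longrightarrow> h \<in> hom C y z \<Longrightarrow>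
      h \<cdot> (g \<cdot> f) = (h \<cdot> g) \<cdot> f"

definition is_inverse :: "('o, 'm, 'x) cat_scheme \<Rightarrow> 'm \<Rightarrow> 'm \<Rightarrow> bool" where
  "is_inverse C f g \<longleftrightarrow>
     f \<in> Arr C \<and> g \<in> hom C (Cod C f) (Dom C f) \<and>
     g \<cdot>\<^bsub>C\<^esub> f = Ident C (Dom C f) \<and> f \<cdot>\<^bsub>C\<^esub> g = Ident C (Cod C f)"

definition is_iso :: "('o, 'm, 'x) cat_scheme \<Rightarrow> 'm \<Rightarrow> bool" where
  "is_iso C f \<longleftrightarrow> (\<exists>g. is_inverse C f g)"

definition full_subcat :: "('o, 'm, 'x) cat_scheme \<Rightarrow> 'o set \<Rightarrow> ('o, 'm) cat" where
  "full_subcat C S =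
     \<lparr>Obj = Obj C \<inter> S,
      Arr = {f \<in> Arr C. Dom C f \<in> S \<and> Cod C f \<in> S},
      Dom = Dom C, Cod = Cod C, Ident = Ident C, Comp = Comp C\<rparr>"

text \<open>Functors and natural transformations are extensional (\<^term>\<open>undefined\<close> off the source
  category), so that strict equality of functors is equality in the logic.\<close>

record ('o, 'm, 'p, 'n) fctr =
  FObj :: "'o \<Rightarrow> 'p"
  FArr :: "'m \<Rightarrow> 'n"

locale is_functor =
  source: category C + target: category D
  for C :: "('o, 'm, 'x) cat_scheme" and D :: "('p, 'n, 'y) cat_scheme" +
  fixes F :: "('o, 'm, 'p, 'n) fctr"
  assumes obj_ext: "FObj F \<in> extensional (Obj C)"
    and arr_ext: "FArr F \<in> extensional (Arr C)"
    and map_obj: "x \<in> Obj C \<Longrightarrow> FObj F x \<in> Obj D"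
    and map_hom: "f \<in> hom C x y \<Longrightarrow> FArr F f \<in> hom D (FObj F x) (FObj F y)"
    and map_ident: "x \<in> Obj C \<Longrightarrow> FArr F (Ident C x) = Ident D (FObj F x)"
    and map_comp: "f \<in> hom C x y \<Longrightarrow> g \<in> hom C y z \<Longrightarrow>
      FArr F (g \<cdot>\<^bsub>C\<^esub> f) = FArr F g \<cdot>\<^bsub>D\<^esub> FArr F f"

text \<open>The composite, with source category \<open>C\<close>. It also makes sense for assignments on objects
  and arrows that are not functors.\<close>

definition fcomp :: "('p, 'n, 'q, 'k) fctr \<Rightarrow> ('o, 'm, 'x) cat_scheme \<Rightarrow>
    ('o, 'm, 'p, 'n) fctr \<Rightarrow> ('o, 'm, 'q, 'k) fctr" ("(_ \<odot>\<^bsub>_\<^esub>/ _)" [56, 0, 55] 55) where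
  "G \<odot>\<^bsub>C\<^esub> F =
     \<lparr>FObj = (\<lambda>x\<in>Obj C. FObj G (FObj F x)),
      FArr = (\<lambda>f\<in>Arr C. FArr G (FArr F f))\<rparr>"

text \<open>The identity functor, or, when only the source \<open>C\<close> is a full subcategory of
  the target, the inclusion functor.\<close>

definition incl :: "('o, 'm, 'x) cat_scheme \<Rightarrow> ('o, 'm, 'o, 'm) fctr" where
  "incl C = \<lparr>FObj = (\<lambda>x\<in>Obj C. x), FArr = (\<lambda>f\<in>Arr C. f)\<rparr>"

definition nat_trans :: "('o, 'm, 'x) cat_scheme \<Rightarrow> ('p, 'n, 'y) cat_scheme \<Rightarrow>
    ('o, 'm, 'p, 'n) fctr \<Rightarrow> ('o, 'm, 'p, 'n) fctr \<Rightarrow> ('o \<Rightarrow> 'n) \<Rightarrow> bool" where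
  "nat_trans C D F G t \<longleftrightarrow>
     is_functor C D F \<and> is_functor C D G \<and> t \<in> extensional (Obj C) \<and>
     (\<forall>x\<in>Obj C. t x \<in> hom D (FObj F x) (FObj G x)) \<and>
     (\<forall>x y. \<forall>f\<in>hom C x y. FArr G f \<cdot>\<^bsub>D\<^esub> t x = t y \<cdot>\<^bsub>D\<^esub> FArr F f)"

definition nat_iso :: "('o, 'm, 'x) cat_scheme \<Rightarrow> ('p, 'n, 'y) cat_scheme \<Rightarrow>
    ('o, 'm, 'p, 'n) fctr \<Rightarrow> ('o, 'm, 'p, 'n) fctr \<Rightarrow> ('o \<Rightarrow> 'n) \<Rightarrow> bool" where
  "nat_iso C D F G t \<longleftrightarrow> nat_trans C D F G t \<and> (\<forall>x\<in>Obj C. is_iso D (t x))"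

definition vcomp :: "('o, 'm, 'x) cat_scheme \<Rightarrow> ('p, 'n, 'y) cat_scheme \<Rightarrow>
    ('o \<Rightarrow> 'n) \<Rightarrow> ('o \<Rightarrow> 'n) \<Rightarrow> ('o \<Rightarrow> 'n)" where
  "vcomp C D s t = (\<lambda>x\<in>Obj C. s x \<cdot>\<^bsub>D\<^esub> t x)"

definition whisker :: "('o, 'm, 'x) cat_scheme \<Rightarrow> ('p \<Rightarrow> 'n) \<Rightarrow> ('o, 'm, 'p, 'k) fctr \<Rightarrow>
    ('o \<Rightarrow> 'n)" where
  "whisker C t P = (\<lambda>x\<in>Obj C. t (FObj P x))"

definition right_Kan_extension ::
    "('o, 'm, 'x) cat_scheme \<Rightarrow> ('p, 'n, 'y) cat_scheme \<Rightarrow> ('q, 'k, 'z) cat_scheme \<Rightarrow>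
     ('o, 'm, 'p, 'n) fctr \<Rightarrow> ('o, 'm, 'q, 'k) fctr \<Rightarrow>
     ('p, 'n, 'q, 'k) fctr \<Rightarrow> ('o \<Rightarrow> 'k) \<Rightarrow> bool" where
  "right_Kan_extension C C' D P G R \<epsilon> \<longleftrightarrow>
     is_functor C C' P \<and> is_functor C D G \<and> is_functor C' D R \<and>
     nat_trans C D (R \<odot>\<^bsub>C\<^esub> P) G \<epsilon> \<and>
     (\<forall>H \<eta>. is_functor C' D H \<and> nat_trans C D (H \<odot>\<^bsub>C\<^esub> P) G \<eta> \<longrightarrow>
        (\<exists>!\<kappa>. nat_trans C' D H R \<kappa> \<and> \<eta> = vcomp C D \<epsilon> (whisker C \<kappa> P)))"

definition comparison_iso ::
    "('o, 'm, 'x) cat_scheme \<Rightarrow> ('p, 'n, 'y) cat_scheme \<Rightarrow> ('q, 'k, 'z) cat_scheme \<Rightarrow>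
     ('o, 'm, 'p, 'n) fctr \<Rightarrow>
     ('p, 'n, 'q, 'k) fctr \<Rightarrow> ('o \<Rightarrow> 'k) \<Rightarrow> ('p, 'n, 'q, 'k) fctr \<Rightarrow> ('o \<Rightarrow> 'k) \<Rightarrow>
     ('p \<Rightarrow> 'k) \<Rightarrow> bool" where
  "comparison_iso C C' D P R \<epsilon> R' \<epsilon>' \<kappa> \<longleftrightarrow>
     nat_iso C' D R R' \<kappa> \<and> \<epsilon> = vcomp C D \<epsilon>' (whisker C \<kappa> P)"


section \<open>Finite limits and colimits\<close>

definition cone :: "('j, 'a, 'w) cat_scheme \<Rightarrow> ('o, 'm, 'x) cat_scheme \<Rightarrow>
    ('j, 'a, 'o, 'm) fctr \<Rightarrow> 'o \<Rightarrow> ('j \<Rightarrow> 'm) \<Rightarrow> bool" where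
  "cone J C T v t \<longleftrightarrow> v \<in> Obj C \<and>
     (\<forall>j\<in>Obj J. t j \<in> hom C v (FObj T j)) \<and>
     (\<forall>a\<in>Arr J. FArr T a \<cdot>\<^bsub>C\<^esub> t (Dom J a) = t (Cod J a))"

definition limit_cone :: "('j, 'a, 'w) cat_scheme \<Rightarrow> ('o, 'm, 'x) cat_scheme \<Rightarrow>
    ('j, 'a, 'o, 'm) fctr \<Rightarrow> 'o \<Rightarrow> ('j \<Rightarrow> 'm) \<Rightarrow> bool" where
  "limit_cone J C T v t \<longleftrightarrow> cone J C T v t \<and>
     (\<forall>w s. cone J C T w s \<longrightarrow>
        (\<exists>!u. u \<in> hom C w v \<and> (\<forall>j\<in>Obj J. t j \<cdot>\<^bsub>C\<^esub> u = s j)))"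

definition cocone :: "('j, 'a, 'w) cat_scheme \<Rightarrow> ('o, 'm, 'x) cat_scheme \<Rightarrow>
    ('j, 'a, 'o, 'm) fctr \<Rightarrow> 'o \<Rightarrow> ('j \<Rightarrow> 'm) \<Rightarrow> bool" where
  "cocone J C T v t \<longleftrightarrow> v \<in> Obj C \<and>
     (\<forall>j\<in>Obj J. t j \<in> hom C (FObj T j) v) \<and>
     (\<forall>a\<in>Arr J. t (Cod J a) \<cdot>\<^bsub>C\<^esub> FArr T a = t (Dom J a))"

definition colimit_cocone :: "('j, 'a, 'w) cat_scheme \<Rightarrow> ('o, 'm, 'x) cat_scheme \<Rightarrow>
    ('j, 'a, 'o, 'm) fctr \<Rightarrow> 'o \<Rightarrow> ('j \<Rightarrow> 'm) \<Rightarrow> bool" where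
  "colimit_cocone J C T v t \<longleftrightarrow> cocone J C T v t \<and>
     (\<forall>w s. cocone J C T w s \<longrightarrow>
        (\<exists>!u. u \<in> hom C v w \<and> (\<forall>j\<in>Obj J. u \<cdot>\<^bsub>C\<^esub> t j = s j)))"

text \<open>Every finite category is isomorphic to one whose objects and arrows are natural numbers,
  so these index categories suffice.\<close>

definition has_finite_limits :: "('o, 'm, 'x) cat_scheme \<Rightarrow> bool" where
  "has_finite_limits C \<longleftrightarrow>
     (\<forall>(J :: (nat, nat) cat) T. finite (Obj J) \<and> finite (Arr J) \<and> is_functor J C T \<longrightarrow>
        (\<exists>v t. limit_cone J C T v t))"

definition has_finite_colimits :: "('o, 'm, 'x) cat_scheme \<Rightarrow> bool" where
  "has_finite_colimits C \<longleftrightarrow>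
     (\<forall>(J :: (nat, nat) cat) T. finite (Obj J) \<and> finite (Arr J) \<and> is_functor J C T \<longrightarrow>
        (\<exists>v t. colimit_cocone J C T v t))"

definition is_initial :: "('o, 'm, 'x) cat_scheme \<Rightarrow> 'o \<Rightarrow> bool" where
  "is_initial C z \<longleftrightarrow> z \<in> Obj C \<and> (\<forall>x\<in>Obj C. \<exists>!f. f \<in> hom C z x)"

definition zero_obj :: "('o, 'm, 'x) cat_scheme \<Rightarrow> 'o" where
  "zero_obj C = (SOME z. is_initial C z)"

definition zero_arr :: "('o, 'm, 'x) cat_scheme \<Rightarrow> 'o \<Rightarrow> 'm" where
  "zero_arr C x = (THE f. f \<in> hom C (zero_obj C) x)"


lemma hom_arr: "f \<in> hom C x y \<Longrightarrow> f \<in> Arr C"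
  and hom_dom: "f \<in> hom C x y \<Longrightarrow> Dom C f = x"
  and hom_cod: "f \<in> hom C x y \<Longrightarrow> Cod C f = y"
  and arr_hom: "f \<in> Arr C \<Longrightarrow> f \<in> hom C (Dom C f) (Cod C f)"
  by (auto simp: hom_def)

lemma (in category) hom_obj: "f \<in> hom C x y \<Longrightarrow> x \<in> Obj C \<and> y \<in> Obj C"
  using dom_obj cod_obj by (auto simp: hom_def)

lemma (in category) inverse_unique:
  assumes "is_inverse C f g" "is_inverse C f h"
  shows "g = h"
proof -
  let ?x = "Dom C f" and ?y = "Cod C f"
  have f: "f \<in> hom C ?x ?y" and g: "g \<in> hom C ?y ?x" and h: "h \<in> hom C ?y ?x"
    using assms by (auto simp: is_inverse_def hom_def)
  have "g = g \<cdot> (f \<cdot> h)" using assms ident_right[OF g] by (simp add: is_inverse_def)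
  also have "\<dots> = (g \<cdot> f) \<cdot> h" using comp_assoc[OF h f g] .
  also have "\<dots> = h" using assms ident_left[OF h] by (simp add: is_inverse_def)
  finally show ?thesis .
qed


section \<open>Model categories\<close>

text \<open>The category of arrows of \<open>C\<close>; the arrow \<open>(f, u, v, g)\<close> from \<open>f\<close> to \<open>g\<close> is the
  commutative square with horizontal sides \<open>u\<close> and \<open>v\<close>.\<close>

definition arrow_cat :: "('o, 'm, 'x) cat_scheme \<Rightarrow> ('m, 'm \<times> 'm \<times> 'm \<times> 'm) cat" where
  "arrow_cat C =
     \<lparr>Obj = Arr C,
      Arr = {(f, u, v, g). f \<in> Arr C \<and> g \<in> Arr C \<and>
               u \<in> hom C (Dom C f) (Dom C g) \<and> v \<in> hom C (Cod C f) (Cod C g) \<and>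
               g \<cdot>\<^bsub>C\<^esub> u = v \<cdot>\<^bsub>C\<^esub> f},
      Dom = (\<lambda>(f, u, v, g). f),
      Cod = (\<lambda>(f, u, v, g). g),
      Ident = (\<lambda>f. (f, Ident C (Dom C f), Ident C (Cod C f), f)),
      Comp = (\<lambda>(_, u', v', h) (f, u, v, _). (f, u' \<cdot>\<^bsub>C\<^esub> u, v' \<cdot>\<^bsub>C\<^esub> v, h))\<rparr>"

definition dom_functor ::
    "('o, 'm, 'x) cat_scheme \<Rightarrow> ('m, 'm \<times> 'm \<times> 'm \<times> 'm, 'o, 'm) fctr" where
  "dom_functor C =
     \<lparr>FObj = (\<lambda>f\<in>Arr C. Dom C f), FArr = (\<lambda>(f, u, v, g)\<in>Arr (arrow_cat C). u)\<rparr>"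

definition cod_functor ::
    "('o, 'm, 'x) cat_scheme \<Rightarrow> ('m, 'm \<times> 'm \<times> 'm \<times> 'm, 'o, 'm) fctr" where
  "cod_functor C =
     \<lparr>FObj = (\<lambda>f\<in>Arr C. Cod C f), FArr = (\<lambda>(f, u, v, g)\<in>Arr (arrow_cat C). v)\<rparr>"

definition functorial_factorization :: "('o, 'm, 'x) cat_scheme \<Rightarrow> 'm set \<Rightarrow> 'm set \<Rightarrow>
    ('m, 'm \<times> 'm \<times> 'm \<times> 'm, 'o, 'm) fctr \<Rightarrow> ('m \<Rightarrow> 'm) \<Rightarrow> ('m \<Rightarrow> 'm) \<Rightarrow> bool" where
  "functorial_factorization C A B E l r \<longleftrightarrow>
     nat_trans (arrow_cat C) C (dom_functor C) E l \<and>
     nat_trans (arrow_cat C) C E (cod_functor C) r \<and>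
     (\<forall>f\<in>Arr C. l f \<in> A \<and> r f \<in> B \<and> r f \<cdot>\<^bsub>C\<^esub> l f = f)"

definition is_retract :: "('o, 'm, 'x) cat_scheme \<Rightarrow> 'm \<Rightarrow> 'm \<Rightarrow> bool" where
  "is_retract C f g \<longleftrightarrow> f \<in> Arr C \<and> g \<in> Arr C \<and>
     (\<exists>i r j s.
        i \<in> hom C (Dom C f) (Dom C g) \<and> r \<in> hom C (Dom C g) (Dom C f) \<and>
        j \<in> hom C (Cod C f) (Cod C g) \<and> s \<in> hom C (Cod C g) (Cod C f) \<and>
        r \<cdot>\<^bsub>C\<^esub> i = Ident C (Dom C f) \<and> s \<cdot>\<^bsub>C\<^esub> j = Ident C (Cod C f) \<and>
        g \<cdot>\<^bsub>C\<^esub> i = j \<cdot>\<^bsub>C\<^esub> f \<and> f \<cdot>\<^bsub>C\<^esub> r = s \<cdot>\<^bsub>C\<^esub> g)"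

definition has_lift :: "('o, 'm, 'x) cat_scheme \<Rightarrow> 'm \<Rightarrow> 'm \<Rightarrow> bool" where
  "has_lift C i p \<longleftrightarrow>
     (\<forall>u v. u \<in> hom C (Dom C i) (Dom C p) \<and> v \<in> hom C (Cod C i) (Cod C p) \<and>
        p \<cdot>\<^bsub>C\<^esub> u = v \<cdot>\<^bsub>C\<^esub> i \<longrightarrow>
        (\<exists>h\<in>hom C (Cod C i) (Dom C p). h \<cdot>\<^bsub>C\<^esub> i = u \<and> p \<cdot>\<^bsub>C\<^esub> h = v))"

definition wide_subcategory :: "('o, 'm, 'x) cat_scheme \<Rightarrow> 'm set \<Rightarrow> bool" where
  "wide_subcategory C A \<longleftrightarrow> A \<subseteq> Arr C \<and> (\<forall>x\<in>Obj C. Ident C x \<in> A) \<and>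
     (\<forall>f\<in>A. \<forall>g\<in>A. Cod C f = Dom C g \<longrightarrow> g \<cdot>\<^bsub>C\<^esub> f \<in> A)"

record ('o, 'm) model = "('o, 'm) cat" +
  Weq :: "'m set"
  Cof :: "'m set"
  Fib :: "'m set"

text \<open>Only finite limits and colimits are required, as in Quillen's definition; model categories
  with all small limits and colimits are a special case.\<close>

locale model_category = category M
  for M :: "('o, 'm, 'x) model_scheme" (structure) +
  assumes finite_limits: "has_finite_limits M"
    and finite_colimits: "has_finite_colimits M"
    and weq_wide: "wide_subcategory M (Weq M)"
    and cof_wide: "wide_subcategory M (Cof M)"
    and fib_wide: "wide_subcategory M (Fib M)"
    and two_of_three: "f \<in> hom M x y \<Longrightarrow> g \<in> hom M y z \<Longrightarrow>
      (f \<in> Weq M \<and> g \<in> Weq M \<longrightarrow> g \<cdot> f \<in> Weq M) \<and>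
      (f \<in> Weq M \<and> g \<cdot> f \<in> Weq M \<longrightarrow> g \<in> Weq M) \<and>
      (g \<in> Weq M \<and> g \<cdot> f \<in> Weq M \<longrightarrow> f \<in> Weq M)"
    and weq_retract: "is_retract M f g \<Longrightarrow> g \<in> Weq M \<Longrightarrow> f \<in> Weq M"
    and cof_retract: "is_retract M f g \<Longrightarrow> g \<in> Cof M \<Longrightarrow> f \<in> Cof M"
    and fib_retract: "is_retract M f g \<Longrightarrow> g \<in> Fib M \<Longrightarrow> f \<in> Fib M"
    and lift_cof_trivial_fib: "i \<in> Cof M \<Longrightarrow> p \<in> Fib M \<inter> Weq M \<Longrightarrow> has_lift M i p"
    and lift_trivial_cof_fib: "i \<in> Cof M \<inter> Weq M \<Longrightarrow> p \<in> Fib M \<Longrightarrow> has_lift M i p"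
    and factor_cof_trivial_fib:
      "\<exists>E l r. functorial_factorization M (Cof M) (Fib M \<inter> Weq M) E l r"
    and factor_trivial_cof_fib:
      "\<exists>E l r. functorial_factorization M (Cof M \<inter> Weq M) (Fib M) E l r"

definition cofibrant :: "('o, 'm, 'x) model_scheme \<Rightarrow> 'o \<Rightarrow> bool" where
  "cofibrant M x \<longleftrightarrow> x \<in> Obj M \<and> zero_arr M x \<in> Cof M"

definition cofibrant_subcat :: "('o, 'm, 'x) model_scheme \<Rightarrow> ('o, 'm) cat" where
  "cofibrant_subcat M = full_subcat M {x. cofibrant M x}"

text \<open>A factorization of the arrows from the initial object to \<open>x\<close> that is functorial in \<open>x\<close>. The
  composite of \<^term>\<open>zero_arr M (FObj Q x)\<close> and \<open>q x\<close> is automatically the arrow from the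
  initial object to \<open>x\<close>.\<close>

definition cofibrant_F_replacement_functor ::
    "('o, 'm, 'x) model_scheme \<Rightarrow> ('o, 'm, 'o, 'm) fctr \<Rightarrow> ('o \<Rightarrow> 'm) \<Rightarrow> bool" where
  "cofibrant_F_replacement_functor M Q q \<longleftrightarrow>
     is_functor M M Q \<and> nat_trans M M Q (incl M) q \<and>
     (\<forall>x\<in>Obj M. zero_arr M (FObj Q x) \<in> Cof M \<and> q x \<in> Fib M \<inter> Weq M)"

text \<open>\<open>Ct\<close> is in general not a functor: \<^term>\<open>FArr Ct f\<close> is an arbitrarily chosen lift.\<close>

definition local_cofibrant_F_replacement ::
    "('o, 'm, 'x) model_scheme \<Rightarrow> ('o, 'm, 'o, 'm) fctr \<Rightarrow> ('o \<Rightarrow> 'm) \<Rightarrow> bool" where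
  "local_cofibrant_F_replacement M Ct c \<longleftrightarrow>
     (\<forall>x\<in>Obj M. FObj Ct x \<in> Obj M \<and> zero_arr M (FObj Ct x) \<in> Cof M \<and>
        c x \<in> hom M (FObj Ct x) x \<and> c x \<in> Fib M \<inter> Weq M \<and>
        (cofibrant M x \<longrightarrow> c x = Ident M x)) \<and>
     (\<forall>x y. \<forall>f\<in>hom M x y. FArr Ct f \<in> hom M (FObj Ct x) (FObj Ct y) \<and>
        c y \<cdot>\<^bsub>M\<^esub> FArr Ct f = f \<cdot>\<^bsub>M\<^esub> c x)"


lemma (in category) is_initial_zero_obj:
  assumes "has_finite_colimits C"
  shows "is_initial C (zero_obj C)"
proof -
  define J :: "(nat, nat) cat" where
    "J = \<lparr>Obj = {}, Arr = {}, Dom = id, Cod = id, Ident = id, Comp = (\<lambda>g f. g)\<rparr>"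
  define T :: "(nat, nat, 'o, 'm) fctr" where
    "T = \<lparr>FObj = (\<lambda>_. undefined), FArr = (\<lambda>_. undefined)\<rparr>"
  have "category J" by unfold_locales (auto simp: J_def hom_def)
  then have "is_functor J C T"
    by (intro is_functor.intro is_functor_axioms.intro category_axioms)
      (auto simp: J_def T_def hom_def)
  then obtain v t where v: "colimit_cocone J C T v t"
    using assms[unfolded has_finite_colimits_def, rule_format, of J T] by (auto simp: J_def)
  have "\<exists>!f. f \<in> hom C v x" if "x \<in> Obj C" for x
    using v that unfolding colimit_cocone_def by (simp add: cocone_def J_def)
  moreover have "v \<in> Obj C" using v by (simp add: colimit_cocone_def cocone_def)
  ultimately have "is_initial C v" by (simp add: is_initial_def)
  then show ?thesis unfolding zero_obj_def by (rule someI)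
qed

lemma (in category) zero_arr:
  assumes "has_finite_colimits C" "x \<in> Obj C"
  shows "zero_arr C x \<in> hom C (zero_obj C) x"
    and "f \<in> hom C (zero_obj C) x \<Longrightarrow> f = zero_arr C x"
proof -
  have *: "\<exists>!f. f \<in> hom C (zero_obj C) x"
    using is_initial_zero_obj[OF assms(1)] assms(2) by (simp add: is_initial_def)
  show **: "zero_arr C x \<in> hom C (zero_obj C) x" unfolding zero_arr_def by (rule theI'[OF *])
  show "f \<in> hom C (zero_obj C) x \<Longrightarrow> f = zero_arr C x" using * ** by blast
qed

lemma (in category) category_arrow_cat: "category (arrow_cat C)"
proof
  fix a assume "a \<in> Arr (arrow_cat C)"
  then show "Dom (arrow_cat C) a \<in> Obj (arrow_cat C)" "Cod (arrow_cat C) a \<in> Obj (arrow_cat C)"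
    by (auto simp: arrow_cat_def)
next
  fix f assume "f \<in> Obj (arrow_cat C)"
  then have f: "f \<in> hom C (Dom C f) (Cod C f)" by (simp add: arrow_cat_def hom_def)
  then show "Ident (arrow_cat C) f \<in> hom (arrow_cat C) f f"
    using ident_left[OF f] ident_right[OF f] hom_obj[OF f] ident_hom
    by (auto simp: arrow_cat_def hom_def)
next
  fix a b f g h
  assume "a \<in> hom (arrow_cat C) f g" "b \<in> hom (arrow_cat C) g h"
  then obtain u v u' v' where a: "a = (f, u, v, g)" and b: "b = (g, u', v', h)"
    and f: "f \<in> hom C (Dom C f) (Cod C f)" and g: "g \<in> hom C (Dom C g) (Cod C g)"
    and h: "h \<in> hom C (Dom C h) (Cod C h)"
    and u: "u \<in> hom C (Dom C f) (Dom C g)" and v: "v \<in> hom C (Cod C f) (Cod C g)"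
    and u': "u' \<in> hom C (Dom C g) (Dom C h)" and v': "v' \<in> hom C (Cod C g) (Cod C h)"
    and sq: "g \<cdot> u = v \<cdot> f" "h \<cdot> u' = v' \<cdot> g"
    by (auto simp: arrow_cat_def hom_def)
  have "h \<cdot> (u' \<cdot> u) = (v' \<cdot> v) \<cdot> f"
    using comp_assoc[OF u u' h] comp_assoc[OF u g v'] comp_assoc[OF f v v'] sq by simp
  then show "b \<cdot>\<^bsub>arrow_cat C\<^esub> a \<in> hom (arrow_cat C) f h"
    using comp_hom[OF u u'] comp_hom[OF v v'] f h
    by (simp add: a b arrow_cat_def hom_def)
next
  fix a f g assume "a \<in> hom (arrow_cat C) f g"
  then obtain u v where a: "a = (f, u, v, g)"
    and u: "u \<in> hom C (Dom C f) (Dom C g)" and v: "v \<in> hom C (Cod C f) (Cod C g)"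
    by (auto simp: arrow_cat_def hom_def)
  show "Ident (arrow_cat C) g \<cdot>\<^bsub>arrow_cat C\<^esub> a = a"
    "a \<cdot>\<^bsub>arrow_cat C\<^esub> Ident (arrow_cat C) f = a"
    using ident_left[OF u] ident_left[OF v] ident_right[OF u] ident_right[OF v]
    by (simp_all add: a arrow_cat_def)
next
  fix a b d e f g h
  assume "a \<in> hom (arrow_cat C) e f" "b \<in> hom (arrow_cat C) f g" "d \<in> hom (arrow_cat C) g h"
  then obtain u v u' v' u'' v'' where
    abd: "a = (e, u, v, f)" "b = (f, u', v', g)" "d = (g, u'', v'', h)"
    and "u \<in> hom C (Dom C e) (Dom C f)" "v \<in> hom C (Cod C e) (Cod C f)"
    "u' \<in> hom C (Dom C f) (Dom C g)" "v' \<in> hom C (Cod C f) (Cod C g)"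
    "u'' \<in> hom C (Dom C g) (Dom C h)" "v'' \<in> hom C (Cod C g) (Cod C h)"
    by (auto simp: arrow_cat_def hom_def)
  then have "u'' \<cdot> (u' \<cdot> u) = (u'' \<cdot> u') \<cdot> u" "v'' \<cdot> (v' \<cdot> v) = (v'' \<cdot> v') \<cdot> v"
    using comp_assoc by blast+
  then show "d \<cdot>\<^bsub>arrow_cat C\<^esub> (b \<cdot>\<^bsub>arrow_cat C\<^esub> a) =
      (d \<cdot>\<^bsub>arrow_cat C\<^esub> b) \<cdot>\<^bsub>arrow_cat C\<^esub> a"
    by (simp add: abd arrow_cat_def)
qed

text \<open>Applying a functorial factorization of \<open>M\<close> to the arrows with source the initial object
  gives a cofibrant F-replacement functor.\<close>

lemma (in model_category) cofibrant_F_replacement_functor_of_factorization: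
  assumes fac: "functorial_factorization M (Cof M) (Fib M \<inter> Weq M) E l r"
  defines "Q \<equiv> \<lparr>FObj = (\<lambda>x\<in>Obj M. FObj E (zero_arr M x)),
      FArr = (\<lambda>f\<in>Arr M. FArr E (zero_arr M (Dom M f), Ident M (zero_obj M), f, zero_arr M (Cod M f)))\<rparr>"
  shows "cofibrant_F_replacement_functor M Q (\<lambda>x\<in>Obj M. r (zero_arr M x))"
proof -
  have l: "nat_trans (arrow_cat M) M (dom_functor M) E l"
    and r: "nat_trans (arrow_cat M) M E (cod_functor M) r"
    and lr: "\<And>f. f \<in> Arr M \<Longrightarrow> l f \<in> Cof M \<and> r f \<in> Fib M \<inter> Weq M \<and> r f \<cdot> l f = f"
    using fac by (simp_all add: functorial_factorization_def)
  interpret E: is_functor "arrow_cat M" M E using r by (simp add: nat_trans_def)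
  have z: "zero_arr M x \<in> hom M (zero_obj M) x" if "x \<in> Obj M" for x
    using zero_arr(1)[OF finite_colimits that] .
  have z_unique: "f = zero_arr M x" if "f \<in> hom M (zero_obj M) x" for f x
    using zero_arr(2)[OF finite_colimits conjunct2[OF hom_obj[OF that]] that] .
  have z_obj: "zero_obj M \<in> Obj M"
    using is_initial_zero_obj[OF finite_colimits] by (simp add: is_initial_def)
  define sq where
    "sq f = (zero_arr M (Dom M f), Ident M (zero_obj M), f, zero_arr M (Cod M f))" for f
  have sq: "sq f \<in> hom (arrow_cat M) (zero_arr M x) (zero_arr M y)" if f: "f \<in> hom M x y" for f x y
  proof -
    have x: "x \<in> Obj M" "y \<in> Obj M" using hom_obj[OF f] by auto
    have "zero_arr M y \<cdot> Ident M (zero_obj M) = zero_arr M y" using ident_right[OF z[OF x(2)]] .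
    moreover have "f \<cdot> zero_arr M x = zero_arr M y"
      using z_unique[OF comp_hom[OF z[OF x(1)] f]] .
    ultimately show ?thesis
      using z[OF x(1)] z[OF x(2)] f ident_hom[OF z_obj]
      by (auto simp: sq_def hom_def arrow_cat_def)
  qed
  have obj: "zero_arr M x \<in> Obj (arrow_cat M)" if "x \<in> Obj M" for x
    using z[OF that] by (simp add: arrow_cat_def hom_def)
  have Q_obj: "FObj Q x = FObj E (zero_arr M x)" if "x \<in> Obj M" for x
    using that by (simp add: Q_def)
  have Q_arr: "FArr Q f = FArr E (sq f)" if "f \<in> hom M x y" for f x y
    using that by (simp add: Q_def sq_def hom_def)
  have Q: "is_functor M M Q"
  proof
    show "FObj Q \<in> extensional (Obj M)" "FArr Q \<in> extensional (Arr M)" by (auto simp: Q_def)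
  next
    fix x assume x: "x \<in> Obj M"
    then show "FObj Q x \<in> Obj M" using E.map_obj[OF obj[OF x]] by (simp add: Q_obj)
    have "sq (Ident M x) = Ident (arrow_cat M) (zero_arr M x)"
      using ident_hom[OF x] z[OF x] by (simp add: sq_def arrow_cat_def hom_def)
    then show "FArr Q (Ident M x) = Ident M (FObj Q x)"
      using x E.map_ident[OF obj[OF x]] by (simp add: Q_obj Q_arr[OF ident_hom[OF x]])
  next
    fix f x y assume f: "f \<in> hom M x y"
    show "FArr Q f \<in> hom M (FObj Q x) (FObj Q y)"
      using E.map_hom[OF sq[OF f]] hom_obj[OF f] by (simp add: Q_obj Q_arr[OF f])
  next
    fix f g x y w assume fg: "f \<in> hom M x y" "g \<in> hom M y w"
    have "sq (g \<cdot> f) = sq g \<cdot>\<^bsub>arrow_cat M\<^esub> sq f"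
      using fg comp_hom[OF fg] ident_left[OF ident_hom[OF z_obj]]
      by (simp add: sq_def arrow_cat_def hom_def)
    then show "FArr Q (g \<cdot> f) = FArr Q g \<cdot> FArr Q f"
      using E.map_comp[OF sq[OF fg(1)] sq[OF fg(2)]]
      by (simp add: Q_arr[OF fg(1)] Q_arr[OF fg(2)] Q_arr[OF comp_hom[OF fg]])
  qed
  have I: "is_functor M M (incl M)"
  proof
    fix f g x y z assume "f \<in> hom M x y" "g \<in> hom M y z"
    then show "FArr (incl M) (g \<cdot> f) = FArr (incl M) g \<cdot> FArr (incl M) f"
      using hom_arr[OF comp_hom] by (simp add: incl_def hom_arr)
  next
    fix f x y assume "f \<in> hom M x y"
    then show "FArr (incl M) f \<in> hom M (FObj (incl M) x) (FObj (incl M) y)"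
      using hom_obj[of f x y] by (simp add: incl_def hom_arr)
  next
    fix x assume "x \<in> Obj M"
    then show "FArr (incl M) (Ident M x) = Ident M (FObj (incl M) x)"
      using hom_arr[OF ident_hom[of x]] by (simp add: incl_def)
  qed (auto simp: incl_def)
  have r_hom: "r (zero_arr M x) \<in> hom M (FObj Q x) x" if x: "x \<in> Obj M" for x
    using r obj[OF x] z[OF x] by (auto simp: nat_trans_def Q_obj[OF x] cod_functor_def hom_def)
  have r_nat: "f \<cdot> r (zero_arr M x) = r (zero_arr M y) \<cdot> FArr Q f" if f: "f \<in> hom M x y" for f x y
  proof -
    have "FArr (cod_functor M) (sq f) \<cdot> r (zero_arr M x) = r (zero_arr M y) \<cdot> FArr E (sq f)"
      using r sq[OF f] unfolding nat_trans_def by blast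
    moreover have "FArr (cod_functor M) (sq f) = f"
      using sq[OF f] by (simp add: cod_functor_def hom_def sq_def)
    ultimately show ?thesis by (simp add: Q_arr[OF f])
  qed
  have nat: "nat_trans M M Q (incl M) (\<lambda>x\<in>Obj M. r (zero_arr M x))"
    unfolding nat_trans_def
  proof (intro conjI allI ballI Q I)
    fix x assume "x \<in> Obj M"
    then show "(\<lambda>x\<in>Obj M. r (zero_arr M x)) x \<in> hom M (FObj Q x) (FObj (incl M) x)"
      using r_hom by (simp add: incl_def)
  next
    fix x y f assume f: "f \<in> hom M x y"
    then show "FArr (incl M) f \<cdot> (\<lambda>x\<in>Obj M. r (zero_arr M x)) x =
        (\<lambda>x\<in>Obj M. r (zero_arr M x)) y \<cdot> FArr Q f"
      using r_nat[OF f] hom_obj[OF f] hom_arr[OF f] by (simp add: incl_def)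
  qed auto
  have "zero_arr M (FObj Q x) \<in> Cof M \<and> r (zero_arr M x) \<in> Fib M \<inter> Weq M" if x: "x \<in> Obj M" for x
  proof -
    have "l (zero_arr M x) \<in> hom M (zero_obj M) (FObj Q x)"
      using l obj[OF x] z[OF x] by (auto simp: nat_trans_def Q_obj[OF x] dom_functor_def hom_def)
    then have "l (zero_arr M x) = zero_arr M (FObj Q x)" by (rule z_unique)
    then show ?thesis using lr[OF hom_arr[OF z[OF x]]] by simp
  qed
  then show ?thesis using Q nat by (simp add: cofibrant_F_replacement_functor_def)
qed


section \<open>Strong localization\<close>

text \<open>The localization of \<open>C\<close> at \<open>W\<close> is built from zigzags of arrows, the steps \<open>Bwd w\<close> being
  formal inverses of the arrows \<open>w\<close> in \<open>W\<close>. A zigzag is listed in the order of traversal.\<close>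

datatype 'm step = Fwd 'm | Bwd 'm

fun zigzag :: "('o, 'm, 'x) cat_scheme \<Rightarrow> 'm set \<Rightarrow> 'o \<Rightarrow> 'm step list \<Rightarrow> 'o \<Rightarrow> bool" where
  "zigzag C W x [] y \<longleftrightarrow> x \<in> Obj C \<and> x = y"
| "zigzag C W x (Fwd f # s) y \<longleftrightarrow> f \<in> Arr C \<and> Dom C f = x \<and> zigzag C W (Cod C f) s y"
| "zigzag C W x (Bwd w # s) y \<longleftrightarrow>
     w \<in> Arr C \<and> w \<in> W \<and> Cod C w = x \<and> zigzag C W (Dom C w) s y"

inductive zigzag_eq :: "('o, 'm, 'x) cat_scheme \<Rightarrow> 'm set \<Rightarrow> 'o \<Rightarrow> 'o \<Rightarrow>
    'm step list \<Rightarrow> 'm step list \<Rightarrow> bool" for C W where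
  refl: "zigzag C W x s y \<Longrightarrow> zigzag_eq C W x y s s"
| sym: "zigzag_eq C W x y s t \<Longrightarrow> zigzag_eq C W x y t s"
| trans: "zigzag_eq C W x y s t \<Longrightarrow> zigzag_eq C W x y t u \<Longrightarrow> zigzag_eq C W x y s u"
| append: "zigzag_eq C W x y s s' \<Longrightarrow> zigzag_eq C W y z t t' \<Longrightarrow>
    zigzag_eq C W x z (s @ t) (s' @ t')"
| ident: "x \<in> Obj C \<Longrightarrow> zigzag_eq C W x x [Fwd (Ident C x)] []"
| comp: "f \<in> hom C x y \<Longrightarrow> g \<in> hom C y z \<Longrightarrow>
    zigzag_eq C W x z [Fwd f, Fwd g] [Fwd (g \<cdot>\<^bsub>C\<^esub> f)]"
| fwd_bwd: "w \<in> hom C x y \<Longrightarrow> w \<in> W \<Longrightarrow> zigzag_eq C W x x [Fwd w, Bwd w] []"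
| bwd_fwd: "w \<in> hom C x y \<Longrightarrow> w \<in> W \<Longrightarrow> zigzag_eq C W y y [Bwd w, Fwd w] []"

definition zigzag_class :: "('o, 'm, 'x) cat_scheme \<Rightarrow> 'm set \<Rightarrow> 'o \<Rightarrow> 'm step list \<Rightarrow> 'o \<Rightarrow>
    'o \<times> 'm step list set \<times> 'o" where
  "zigzag_class C W x s y = (x, {t. zigzag_eq C W x y s t}, y)"

definition localization :: "('o, 'm, 'x) cat_scheme \<Rightarrow> 'm set \<Rightarrow>
    ('o, 'o \<times> 'm step list set \<times> 'o) cat" where
  "localization C W =
     \<lparr>Obj = Obj C,
      Arr = {zigzag_class C W x s y |x s y. zigzag C W x s y},
      Dom = (\<lambda>(x, _, _). x),
      Cod = (\<lambda>(_, _, y). y),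
      Ident = (\<lambda>x. zigzag_class C W x [] x),
      Comp = (\<lambda>(_, T, z) (x, S, _).
        (x, {u. \<exists>s\<in>S. \<exists>t\<in>T. zigzag_eq C W x z (s @ t) u}, z))\<rparr>"

definition loc_functor :: "('o, 'm, 'x) cat_scheme \<Rightarrow> 'm set \<Rightarrow>
    ('o, 'm, 'o, 'o \<times> 'm step list set \<times> 'o) fctr" where
  "loc_functor C W =
     \<lparr>FObj = (\<lambda>x\<in>Obj C. x),
      FArr = (\<lambda>f\<in>Arr C. zigzag_class C W (Dom C f) [Fwd f] (Cod C f))\<rparr>"

text \<open>The functor out of the localization induced by \<open>G\<close>; by the theorem
  \<open>localization_universal\<close> below it is well defined whenever \<open>G\<close> is a functor that sends \<open>W\<close>
  to isomorphisms.\<close>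

definition loc_ext :: "('o, 'm, 'x) cat_scheme \<Rightarrow> 'm set \<Rightarrow> ('p, 'n, 'y) cat_scheme \<Rightarrow>
    ('o, 'm, 'p, 'n) fctr \<Rightarrow> ('o, 'o \<times> 'm step list set \<times> 'o, 'p, 'n) fctr" where
  "loc_ext C W D G =
     (THE H. is_functor (localization C W) D H \<and> H \<odot>\<^bsub>C\<^esub> loc_functor C W = G)"

lemma functor_is_inverse:
  assumes "is_functor C D F" "is_inverse C f g"
  shows "is_inverse D (FArr F f) (FArr F g)"
proof -
  interpret is_functor C D F by fact
  let ?x = "Dom C f" and ?y = "Cod C f"
  have f: "f \<in> hom C ?x ?y" and g: "g \<in> hom C ?y ?x"
    using assms by (auto simp: is_inverse_def hom_def)
  have x: "?x \<in> Obj C" "?y \<in> Obj C" using source.hom_obj[OF f] by auto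
  have Ff: "FArr F f \<in> hom D (FObj F ?x) (FObj F ?y)" using map_hom[OF f] .
  show ?thesis
    using map_hom[OF g] map_comp[OF f g] map_comp[OF g f] assms(2) Ff x
    by (auto simp: is_inverse_def hom_arr[OF Ff] hom_dom[OF Ff] hom_cod[OF Ff] map_ident)
qed

lemma fctr_eqI:
  fixes F G :: "('o, 'm, 'p, 'n) fctr"
  shows "FObj F = FObj G \<Longrightarrow> FArr F = FArr G \<Longrightarrow> F = G"
  by simp

context category begin

lemma zigzag_objs: "zigzag C W x s y \<Longrightarrow> x \<in> Obj C \<and> y \<in> Obj C"
proof (induction s arbitrary: x)
  case (Cons a s)
  then show ?case by (cases a) (auto simp: dom_obj cod_obj)
qed simp

lemma zigzag_append: "zigzag C W x s y \<Longrightarrow> zigzag C W y t z \<Longrightarrow> zigzag C W x (s @ t) z"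
  by (induction C W x s y rule: zigzag.induct) auto

lemma zigzag_eq_zigzag: "zigzag_eq C W x y s t \<Longrightarrow> zigzag C W x s y \<and> zigzag C W x t y"
proof (induction rule: zigzag_eq.induct)
  case (ident x)
  then show ?case using ident_hom[of x] by (auto simp: hom_def)
next
  case (comp f x y g z)
  then show ?case using comp_hom[of f x y g z] hom_obj[of g y z] by (auto simp: hom_def)
next
  case (fwd_bwd w x y)
  then show ?case using hom_obj[of w x y] by (auto simp: hom_def)
next
  case (bwd_fwd w x y)
  then show ?case using hom_obj[of w x y] by (auto simp: hom_def)
qed (auto intro: zigzag_append)

lemma zigzag_class_eq_iff:
  assumes "zigzag C W x s y"
  shows "zigzag_class C W x s y = zigzag_class C W x' s' y' \<longleftrightarrow>
    x' = x \<and> y' = y \<and> zigzag_eq C W x y s s'"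
proof
  assume "zigzag_class C W x s y = zigzag_class C W x' s' y'"
  then have *: "x' = x" "y' = y" "{t. zigzag_eq C W x y s t} = {t. zigzag_eq C W x y s' t}"
    by (auto simp: zigzag_class_def)
  then have "zigzag_eq C W x y s' s" using zigzag_eq.refl[OF assms] by auto
  with * show "x' = x \<and> y' = y \<and> zigzag_eq C W x y s s'" by (auto intro: zigzag_eq.sym)
next
  assume "x' = x \<and> y' = y \<and> zigzag_eq C W x y s s'"
  then show "zigzag_class C W x s y = zigzag_class C W x' s' y'"
    by (auto simp: zigzag_class_def intro: zigzag_eq.sym zigzag_eq.trans)
qed

lemma zigzag_class_eqI:
  assumes "zigzag_eq C W x y s s'"
  shows "zigzag_class C W x s y = zigzag_class C W x s' y"
  using zigzag_class_eq_iff[of W x s y x s' y] zigzag_eq_zigzag[OF assms] assms by auto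

lemma loc_comp:
  assumes s: "zigzag C W x s y" and t: "zigzag C W y t z"
  shows "zigzag_class C W y t z \<cdot>\<^bsub>localization C W\<^esub> zigzag_class C W x s y =
    zigzag_class C W x (s @ t) z"
proof -
  have "{u. \<exists>s'\<in>{s'. zigzag_eq C W x y s s'}. \<exists>t'\<in>{t'. zigzag_eq C W y z t t'}.
      zigzag_eq C W x z (s' @ t') u} = {u. zigzag_eq C W x z (s @ t) u}"
    using zigzag_eq.refl[OF s] zigzag_eq.refl[OF t]
    by (auto intro: zigzag_eq.trans[OF zigzag_eq.append])
  then show ?thesis by (simp add: localization_def zigzag_class_def)
qed

lemma loc_hom: "a \<in> hom (localization C W) x y \<longleftrightarrow>
    (\<exists>s. zigzag C W x s y \<and> a = zigzag_class C W x s y)"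
  by (auto simp: hom_def localization_def zigzag_class_def)

lemma loc_homI: "zigzag C W x s y \<Longrightarrow> zigzag_class C W x s y \<in> hom (localization C W) x y"
  by (auto simp: loc_hom)

lemma loc_simps [simp]:
  "Obj (localization C W) = Obj C"
  "Ident (localization C W) x = zigzag_class C W x [] x"
  "Dom (localization C W) (zigzag_class C W x s y) = x"
  "Cod (localization C W) (zigzag_class C W x s y) = y"
  by (auto simp: localization_def zigzag_class_def)

lemma category_localization: "category (localization C W)"
proof
  fix a assume "a \<in> Arr (localization C W)"
  then show "Dom (localization C W) a \<in> Obj (localization C W)"
    "Cod (localization C W) a \<in> Obj (localization C W)"
    by (auto simp: localization_def zigzag_class_def dest: zigzag_objs)
next
  fix x assume "x \<in> Obj (localization C W)"
  then show "Ident (localization C W) x \<in> hom (localization C W) x x"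
    by (simp add: loc_homI)
next
  fix a b x y z
  assume "a \<in> hom (localization C W) x y" "b \<in> hom (localization C W) y z"
  then show "b \<cdot>\<^bsub>localization C W\<^esub> a \<in> hom (localization C W) x z"
    by (auto simp: loc_hom loc_comp intro: zigzag_append)
next
  fix a x y assume "a \<in> hom (localization C W) x y"
  then obtain s where s: "zigzag C W x s y" "a = zigzag_class C W x s y"
    by (auto simp: loc_hom)
  have "zigzag C W x [] x" "zigzag C W y [] y" using zigzag_objs[OF s(1)] by auto
  with s show "Ident (localization C W) y \<cdot>\<^bsub>localization C W\<^esub> a = a"
    "a \<cdot>\<^bsub>localization C W\<^esub> Ident (localization C W) x = a"
    by (simp_all add: loc_comp del: zigzag.simps)
next
  fix a b d w x y z
  assume "a \<in> hom (localization C W) w x" "b \<in> hom (localization C W) x y"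
    "d \<in> hom (localization C W) y z"
  then obtain s t u where "zigzag C W w s x" "a = zigzag_class C W w s x"
    "zigzag C W x t y" "b = zigzag_class C W x t y"
    "zigzag C W y u z" "d = zigzag_class C W y u z"
    by (auto simp: loc_hom)
  then show "d \<cdot>\<^bsub>localization C W\<^esub> (b \<cdot>\<^bsub>localization C W\<^esub> a) =
      (d \<cdot>\<^bsub>localization C W\<^esub> b) \<cdot>\<^bsub>localization C W\<^esub> a"
    using zigzag_append by (metis loc_comp append_assoc)
qed

lemma zigzag_fwd: "f \<in> hom C x y \<Longrightarrow> zigzag C W x [Fwd f] y"
  using hom_obj[of f x y] by (auto simp: hom_def)

lemma zigzag_bwd: "w \<in> hom C x y \<Longrightarrow> w \<in> W \<Longrightarrow> zigzag C W y [Bwd w] x"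
  using hom_obj[of w x y] by (auto simp: hom_def)

lemma loc_functor_arr:
  "f \<in> hom C x y \<Longrightarrow> FArr (loc_functor C W) f = zigzag_class C W x [Fwd f] y"
  by (auto simp: loc_functor_def hom_def)

lemma loc_functor_obj: "x \<in> Obj C \<Longrightarrow> FObj (loc_functor C W) x = x"
  by (simp add: loc_functor_def)

theorem is_functor_loc_functor: "is_functor C (localization C W) (loc_functor C W)"
proof -
  interpret L: category "localization C W" by (rule category_localization)
  show ?thesis
  proof
    show "FObj (loc_functor C W) \<in> extensional (Obj C)"
      "FArr (loc_functor C W) \<in> extensional (Arr C)"
      by (auto simp: loc_functor_def)
  next
    fix x assume x: "x \<in> Obj C"
    then show "FObj (loc_functor C W) x \<in> Obj (localization C W)"
      by (simp add: loc_functor_def)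
    show "FArr (loc_functor C W) (Ident C x) =
        Ident (localization C W) (FObj (loc_functor C W) x)"
      using x by (simp add: loc_functor_arr[OF ident_hom] loc_functor_obj
        zigzag_class_eqI[OF zigzag_eq.ident])
  next
    fix f x y assume f: "f \<in> hom C x y"
    then show "FArr (loc_functor C W) f \<in>
        hom (localization C W) (FObj (loc_functor C W) x) (FObj (loc_functor C W) y)"
      using loc_homI[OF zigzag_fwd[OF f]] hom_obj[OF f]
      by (simp add: loc_functor_arr loc_functor_obj)
  next
    fix f g x y z assume fg: "f \<in> hom C x y" "g \<in> hom C y z"
    show "FArr (loc_functor C W) (g \<cdot> f) =
        FArr (loc_functor C W) g \<cdot>\<^bsub>localization C W\<^esub> FArr (loc_functor C W) f"
      unfolding loc_functor_arr[OF fg(1)] loc_functor_arr[OF fg(2)]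
        loc_functor_arr[OF comp_hom[OF fg]] loc_comp[OF zigzag_fwd[OF fg(1)] zigzag_fwd[OF fg(2)]]
      using zigzag_class_eqI[OF zigzag_eq.comp[OF fg]] by simp
  qed
qed

lemma loc_bwd_inverse:
  assumes w: "w \<in> hom C x y" "w \<in> W"
  shows "is_inverse (localization C W) (FArr (loc_functor C W) w) (zigzag_class C W y [Bwd w] x)"
proof -
  have "zigzag_class C W y [Bwd w] x \<in> hom (localization C W) y x"
    "zigzag_class C W x [Fwd w] y \<in> hom (localization C W) x y"
    using loc_homI[OF zigzag_bwd[OF w]] loc_homI[OF zigzag_fwd[OF w(1)]] by auto
  then show ?thesis
    using zigzag_class_eqI[OF zigzag_eq.fwd_bwd[OF w]] zigzag_class_eqI[OF zigzag_eq.bwd_fwd[OF w]]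
    by (auto simp: is_inverse_def loc_functor_arr[OF w(1)] hom_arr
      loc_comp[OF zigzag_fwd[OF w(1)] zigzag_bwd[of w x y, OF w]]
      loc_comp[OF zigzag_bwd[of w x y, OF w] zigzag_fwd[OF w(1)]])
qed

theorem loc_functor_inverts:
  "w \<in> Arr C \<Longrightarrow> w \<in> W \<Longrightarrow> is_iso (localization C W) (FArr (loc_functor C W) w)"
  unfolding is_iso_def using loc_bwd_inverse[OF arr_hom] by blast

end

fun zigzag_eval :: "('p, 'n, 'y) cat_scheme \<Rightarrow> ('o, 'm, 'p, 'n) fctr \<Rightarrow> 'o \<Rightarrow>
    'm step list \<Rightarrow> 'n" where
  "zigzag_eval D G y [] = Ident D (FObj G y)"
| "zigzag_eval D G y (Fwd f # s) = zigzag_eval D G y s \<cdot>\<^bsub>D\<^esub> FArr G f"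
| "zigzag_eval D G y (Bwd w # s) =
     zigzag_eval D G y s \<cdot>\<^bsub>D\<^esub> (SOME h. is_inverse D (FArr G w) h)"

theorem localization_universal:
  assumes G: "is_functor C D G" and iso: "\<And>w. w \<in> Arr C \<Longrightarrow> w \<in> W \<Longrightarrow> is_iso D (FArr G w)"
  shows "\<exists>!H. is_functor (localization C W) D H \<and> H \<odot>\<^bsub>C\<^esub> loc_functor C W = G"
proof -
  interpret G: is_functor C D G by fact
  interpret L: category "localization C W" by (rule G.source.category_localization)
  interpret P: is_functor C "localization C W" "loc_functor C W"
    by (rule G.source.is_functor_loc_functor)
  let ?L = "localization C W" and ?P = "loc_functor C W"
  let ?ev = "zigzag_eval D G"
  define inv where "inv w = (SOME h. is_inverse D (FArr G w) h)" for w
  have inv: "is_inverse D (FArr G w) (inv w)" if "w \<in> Arr C" "w \<in> W" for w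
    unfolding inv_def using iso[OF that] by (auto simp: is_iso_def intro: someI)
  have inv_hom: "inv w \<in> hom D (FObj G y) (FObj G x)" if "w \<in> hom C x y" "w \<in> W" for w x y
    using inv[OF hom_arr[OF that(1)] that(2)] G.map_hom[OF that(1)]
    by (auto simp: is_inverse_def hom_def)
  have inv_comp: "inv w \<cdot>\<^bsub>D\<^esub> FArr G w = Ident D (FObj G x)"
    "FArr G w \<cdot>\<^bsub>D\<^esub> inv w = Ident D (FObj G y)" if "w \<in> hom C x y" "w \<in> W" for w x y
    using inv[OF hom_arr[OF that(1)] that(2)] G.map_hom[OF that(1)]
    by (auto simp: is_inverse_def hom_def)
  have ev_bwd: "?ev y (Bwd w # s) = ?ev y s \<cdot>\<^bsub>D\<^esub> inv w" for y w s
    by (simp add: inv_def)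
  have ev_hom: "?ev y s \<in> hom D (FObj G x) (FObj G y)" if "zigzag C W x s y" for x s y
    using that
  proof (induction s arbitrary: x)
    case Nil
    then show ?case using G.target.ident_hom G.map_obj by auto
  next
    case (Cons a s)
    show ?case
    proof (cases a)
      case (Fwd f)
      then show ?thesis
        using Cons G.target.comp_hom[OF G.map_hom[OF arr_hom]] by auto
    next
      case (Bwd w)
      then show ?thesis
        using Cons G.target.comp_hom[OF inv_hom[OF arr_hom]] by (auto simp: ev_bwd simp del: zigzag_eval.simps)
    qed
  qed
  have ev_append: "?ev z (s @ t) = ?ev z t \<cdot>\<^bsub>D\<^esub> ?ev y s"
    if "zigzag C W x s y" "zigzag C W y t z" for x y z s t
    using that
  proof (induction s arbitrary: x)
    case Nil
    then show ?case using G.target.ident_right[OF ev_hom[OF Nil(2)]] by simp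
  next
    case (Cons a s)
    show ?case
    proof (cases a)
      case (Fwd f)
      with Cons have f: "f \<in> hom C x (Cod C f)" "zigzag C W (Cod C f) s y" by (auto simp: hom_def)
      show ?thesis
        using Cons.IH[OF f(2) Cons.prems(2)]
          G.target.comp_assoc[OF G.map_hom[OF f(1)] ev_hom[OF f(2)] ev_hom[OF Cons.prems(2)]] Fwd
        by simp
    next
      case (Bwd w)
      with Cons have w: "w \<in> hom C (Dom C w) x" "w \<in> W" "zigzag C W (Dom C w) s y"
        by (auto simp: hom_def)
      show ?thesis
        using Cons.IH[OF w(3) Cons.prems(2)]
          G.target.comp_assoc[OF inv_hom[OF w(1,2)] ev_hom[OF w(3)] ev_hom[OF Cons.prems(2)]] Bwd
        by (simp add: ev_bwd del: zigzag_eval.simps)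
    qed
  qed
  have ev_fwd: "?ev y [Fwd f] = FArr G f" if "f \<in> hom C x y" for f x y
    using G.target.ident_left[OF G.map_hom[OF that]] by simp
  have ev_eq: "?ev y s = ?ev y t" if "zigzag_eq C W x y s t" for x y s t
    using that
  proof (induction rule: zigzag_eq.induct)
    case (append x y s s' z t t')
    then have "zigzag C W x s y" "zigzag C W x s' y" "zigzag C W y t z" "zigzag C W y t' z"
      using G.source.zigzag_eq_zigzag by blast+
    then show ?case using append ev_append by simp
  next
    case (ident x)
    then show ?case
      using G.map_ident[OF ident] ev_fwd[OF G.source.ident_hom[OF ident]] by simp
  next
    case (comp f x y g z)
    have "?ev z [Fwd f, Fwd g] = ?ev z [Fwd g] \<cdot>\<^bsub>D\<^esub> FArr G f" by simp
    then show ?case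
      unfolding ev_fwd[OF comp(2)] ev_fwd[OF G.source.comp_hom[OF comp]]
      using G.map_comp[OF comp] by simp
  next
    case (fwd_bwd w x y)
    then show ?case
      using G.target.ident_left[OF inv_hom[OF fwd_bwd]] inv_comp[OF fwd_bwd]
      by (simp add: inv_def[symmetric])
  next
    case (bwd_fwd w x y)
    then show ?case
      using G.target.ident_left[OF G.map_hom[OF bwd_fwd(1)]] inv_comp[OF bwd_fwd]
      by (simp add: inv_def[symmetric])
  qed auto
  define H where "H = \<lparr>FObj = FObj G,
    FArr = (\<lambda>(x, S, y)\<in>Arr ?L. ?ev y (SOME s. s \<in> S))\<rparr>"
  have H_obj: "FObj H = FObj G" by (simp add: H_def)
  have H_arr: "FArr H (zigzag_class C W x s y) = ?ev y s" if "zigzag C W x s y" for x s y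
  proof -
    have "zigzag_eq C W x y s (SOME t. zigzag_eq C W x y s t)"
      using zigzag_eq.refl[OF that] by (rule someI)
    moreover have "(x, {t. zigzag_eq C W x y s t}, y) \<in> Arr ?L"
      using that by (auto simp: localization_def zigzag_class_def)
    ultimately show ?thesis
      using ev_eq by (auto simp: H_def zigzag_class_def)
  qed
  have H: "is_functor ?L D H"
  proof
    show "FObj H \<in> extensional (Obj ?L)" "FArr H \<in> extensional (Arr ?L)"
      using G.obj_ext by (auto simp: H_def)
  next
    fix x assume "x \<in> Obj ?L"
    then have x: "x \<in> Obj C" by simp
    show "FObj H x \<in> Obj D" using x G.map_obj by (simp add: H_obj)
    show "FArr H (Ident ?L x) = Ident D (FObj H x)" using x by (simp add: H_obj H_arr)
  next
    fix a x y assume "a \<in> hom ?L x y"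
    then show "FArr H a \<in> hom D (FObj H x) (FObj H y)"
      using ev_hom by (auto simp: G.source.loc_hom H_arr H_obj)
  next
    fix a b x y z assume "a \<in> hom ?L x y" "b \<in> hom ?L y z"
    then show "FArr H (b \<cdot>\<^bsub>?L\<^esub> a) = FArr H b \<cdot>\<^bsub>D\<^esub> FArr H a"
      using G.source.zigzag_append ev_append
      by (fastforce simp: G.source.loc_hom H_arr G.source.loc_comp)
  qed
  have H_ext: "H \<odot>\<^bsub>C\<^esub> ?P = G"
  proof (rule fctr_eqI)
    show "FObj (H \<odot>\<^bsub>C\<^esub> ?P) = FObj G"
      using G.obj_ext by (auto simp: fcomp_def H_obj loc_functor_def extensional_def)
    show "FArr (H \<odot>\<^bsub>C\<^esub> ?P) = FArr G"
    proof
      fix f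
      show "FArr (H \<odot>\<^bsub>C\<^esub> ?P) f = FArr G f"
      proof (cases "f \<in> Arr C")
        case True
        then show ?thesis
          using H_arr[OF G.source.zigzag_fwd[OF arr_hom[OF True]]] ev_fwd[OF arr_hom[OF True]]
          by (simp add: fcomp_def G.source.loc_functor_arr[OF arr_hom[OF True]])
      next
        case False
        then show ?thesis using G.arr_ext by (auto simp: fcomp_def extensional_def)
      qed
    qed
  qed
  have unique: "K = H" if K: "is_functor ?L D K" and K_ext: "K \<odot>\<^bsub>C\<^esub> ?P = G" for K
  proof -
    interpret K: is_functor ?L D K by fact
    have K_obj: "FObj K x = FObj G x" if "x \<in> Obj C" for x
      using arg_cong[OF K_ext, of "\<lambda>F. FObj F x"] that
      by (simp add: fcomp_def G.source.loc_functor_obj)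
    have K_fwd: "FArr K (FArr ?P f) = FArr G f" if "f \<in> Arr C" for f
      using arg_cong[OF K_ext, of "\<lambda>F. FArr F f"] that by (simp add: fcomp_def)
    have K_bwd: "FArr K (zigzag_class C W y [Bwd w] x) = inv w"
      if "w \<in> hom C x y" "w \<in> W" for w x y
      using functor_is_inverse[OF K G.source.loc_bwd_inverse[OF that]] inv[OF hom_arr[OF that(1)] that(2)]
        K_fwd[OF hom_arr[OF that(1)]] G.target.inverse_unique by auto
    have K_ev: "FArr K (zigzag_class C W x s y) = ?ev y s" if "zigzag C W x s y" for x s y
      using that
    proof (induction s arbitrary: x)
      case Nil
      then show ?case using K.map_ident[of x] K_obj[of x] by auto
    next
      case (Cons a s)
      show ?case
      proof (cases a)
        case (Fwd f)
        with Cons have f: "f \<in> hom C x (Cod C f)" and s: "zigzag C W (Cod C f) s y"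
          by (auto simp: hom_def)
        have "zigzag_class C W x (a # s) y =
            zigzag_class C W (Cod C f) s y \<cdot>\<^bsub>?L\<^esub> zigzag_class C W x [Fwd f] (Cod C f)"
          using G.source.loc_comp[OF G.source.zigzag_fwd[OF f] s] Fwd by simp
        moreover have "zigzag_class C W (Cod C f) s y \<in> hom ?L (Cod C f) y"
          "zigzag_class C W x [Fwd f] (Cod C f) \<in> hom ?L x (Cod C f)"
          using G.source.loc_homI[OF s] G.source.loc_homI[OF G.source.zigzag_fwd[OF f]] by auto
        ultimately show ?thesis
          using K.map_comp Cons.IH[OF s] K_fwd[OF hom_arr[OF f]] Fwd
          by (simp add: G.source.loc_functor_arr[OF f])
      next
        case (Bwd w)
        with Cons have w: "w \<in> hom C (Dom C w) x" "w \<in> W" and s: "zigzag C W (Dom C w) s y"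
          by (auto simp: hom_def)
        have "zigzag_class C W x (a # s) y =
            zigzag_class C W (Dom C w) s y \<cdot>\<^bsub>?L\<^esub> zigzag_class C W x [Bwd w] (Dom C w)"
          using G.source.loc_comp[OF G.source.zigzag_bwd[OF w] s] Bwd by simp
        moreover have "zigzag_class C W (Dom C w) s y \<in> hom ?L (Dom C w) y"
          "zigzag_class C W x [Bwd w] (Dom C w) \<in> hom ?L x (Dom C w)"
          using G.source.loc_homI[OF s] G.source.loc_homI[OF G.source.zigzag_bwd[OF w]] by auto
        ultimately show ?thesis
          using K.map_comp Cons.IH[OF s] K_bwd[OF w] Bwd
          by (simp add: ev_bwd del: zigzag_eval.simps)
      qed
    qed
    show "K = H"
    proof (rule fctr_eqI)
      show "FObj K = FObj H"
      proof
        fix x show "FObj K x = FObj H x"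
          using K_obj[of x] K.obj_ext G.obj_ext
          by (cases "x \<in> Obj C") (auto simp: H_obj extensional_def)
      qed
      show "FArr K = FArr H"
      proof
        fix a show "FArr K a = FArr H a"
        proof (cases "a \<in> Arr ?L")
          case True
          then obtain x s y where "zigzag C W x s y" "a = zigzag_class C W x s y"
            by (auto simp: localization_def)
          then show ?thesis using K_ev H_arr by metis
        next
          case False
          then show ?thesis
            using extensional_arb[OF K.arr_ext] extensional_arb[OF is_functor.arr_ext[OF H]] by simp
        qed
      qed
    qed
  qed
  show ?thesis
  proof (rule ex1I[of _ H])
    show "is_functor ?L D H \<and> H \<odot>\<^bsub>C\<^esub> ?P = G" using H H_ext by simp
  qed (use unique in simp)
qed

corollary loc_ext:
  assumes "is_functor C D G" and "\<And>w. w \<in> Arr C \<Longrightarrow> w \<in> W \<Longrightarrow> is_iso D (FArr G w)"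
  shows "is_functor (localization C W) D (loc_ext C W D G)"
    and "loc_ext C W D G \<odot>\<^bsub>C\<^esub> loc_functor C W = G"
  using theI'[OF localization_universal[OF assms]] by (simp_all add: loc_ext_def)


section \<open>Homotopy categories and derived functors\<close>

definition Ho :: "('o, 'm, 'x) model_scheme \<Rightarrow> ('o, 'o \<times> 'm step list set \<times> 'o) cat" where
  "Ho M = localization M (Weq M)"

definition ho_functor :: "('o, 'm, 'x) model_scheme \<Rightarrow>
    ('o, 'm, 'o, 'o \<times> 'm step list set \<times> 'o) fctr" ("\<gamma>") where
  "\<gamma> M = loc_functor M (Weq M)"

definition weq_cofibrant :: "('o, 'm, 'x) model_scheme \<Rightarrow> 'm set" where
  "weq_cofibrant M = Weq M \<inter> Arr (cofibrant_subcat M)"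

definition Ho_c :: "('o, 'm, 'x) model_scheme \<Rightarrow> ('o, 'o \<times> 'm step list set \<times> 'o) cat" where
  "Ho_c M = localization (cofibrant_subcat M) (weq_cofibrant M)"

definition ho_functor_c :: "('o, 'm, 'x) model_scheme \<Rightarrow>
    ('o, 'm, 'o, 'o \<times> 'm step list set \<times> 'o) fctr" ("\<gamma>\<^sub>c") where
  "\<gamma>\<^sub>c M = loc_functor (cofibrant_subcat M) (weq_cofibrant M)"

text \<open>\<open>Ho_ext M N T\<close> is the functor usually written \<open>Ho(T)\<close>, for an assignment \<open>T\<close> from \<open>M\<close> to
  \<open>N\<close> whose composite with \<^term>\<open>\<gamma> N\<close> is a functor that inverts weak equivalences.\<close>

definition Ho_ext :: "('o, 'm, 'x) model_scheme \<Rightarrow> ('p, 'n, 'y) model_scheme \<Rightarrow>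
    ('o, 'm, 'p, 'n) fctr \<Rightarrow>
    ('o, 'o \<times> 'm step list set \<times> 'o, 'p, 'p \<times> 'n step list set \<times> 'p) fctr" where
  "Ho_ext M N T = loc_ext M (Weq M) (Ho N) (\<gamma> N \<odot>\<^bsub>M\<^esub> T)"

definition S_derived_functor :: "('o, 'm, 'x) model_scheme \<Rightarrow> ('p, 'n, 'y) model_scheme \<Rightarrow>
    ('o, 'm, 'o, 'm) fctr \<Rightarrow> ('o, 'm, 'p, 'n) fctr \<Rightarrow>
    ('o, 'o \<times> 'm step list set \<times> 'o, 'p, 'p \<times> 'n step list set \<times> 'p) fctr" where
  "S_derived_functor M N Q F =
     loc_ext (cofibrant_subcat M) (weq_cofibrant M) (Ho N)
       (\<gamma> N \<odot>\<^bsub>cofibrant_subcat M\<^esub> F \<odot>\<^bsub>cofibrant_subcat M\<^esub> incl (cofibrant_subcat M))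
     \<odot>\<^bsub>Ho M\<^esub> loc_ext M (Weq M) (Ho_c M) (\<gamma>\<^sub>c M \<odot>\<^bsub>M\<^esub> Q)"

text \<open>A relation rather than a function: such a pair \<open>(L, \<epsilon>)\<close> is determined only up to a unique
  \<^const>\<open>comparison_iso\<close>.\<close>

definition K_derived_functor :: "('o, 'm, 'x) model_scheme \<Rightarrow> ('p, 'n, 'y) model_scheme \<Rightarrow>
    ('o, 'm, 'p, 'n) fctr \<Rightarrow>
    ('o, 'o \<times> 'm step list set \<times> 'o, 'p, 'p \<times> 'n step list set \<times> 'p) fctr \<Rightarrow>
    ('o \<Rightarrow> 'p \<times> 'n step list set \<times> 'p) \<Rightarrow> bool" where
  "K_derived_functor M N F L \<epsilon> \<longleftrightarrow>
     right_Kan_extension M (Ho M) (Ho N) (\<gamma> M) (\<gamma> N \<odot>\<^bsub>M\<^esub> F) L \<epsilon>"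

end

theory Submission
  imports Defs
begin

text \<open>
  The argument runs on one construction, a choice for every object \<open>x\<close> of a weak equivalence
  \<open>t x\<close> from a cofibrant object \<open>T x\<close> to \<open>x\<close>, and for every arrow \<open>f\<close> of a lift \<open>T f\<close> along these. Both the local replacement and the
  replacement functor are of this kind (\<open>cofibrant_resolution\<close>), and the functor \<open>G = \<gamma> N \<circ> F\<close>
  enters only through the fact that it inverts weak equivalences between cofibrant objects.

  First, \<open>G \<circ> T\<close> is a functor although \<open>T\<close> need not be one, because \<open>G\<close> cannot distinguish two
  lifts of the same arrow. Instead of relating the lifts by a left homotopy, one compares them by
  means of a functorial replacement \<open>Q\<close>: if \<open>w \<circ> a = w \<circ> b\<close> with \<open>w\<close> a weak equivalence, then
  \<open>Q w \<circ> Q a = Q w \<circ> Q b\<close>, and \<open>Q w\<close> is a weak equivalence between cofibrant objects, so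
  \<open>G (Q a) = G (Q b)\<close>. When the common source of \<open>a\<close> and \<open>b\<close> is cofibrant, \<open>G\<close> inverts
  the component of \<open>Q \<Rightarrow> id\<close> there as well, and naturality gives \<open>G a = G b\<close>
  (\<open>weq_equalized_eq\<close>).

  Second, \<open>Ho(G \<circ> T)\<close> with the counit \<open>G (t x)\<close> is a right Kan extension
  (\<open>right_Kan_extension_derived\<close>). Given \<open>\<eta>: H \<circ> \<gamma> \<Rightarrow> G\<close>, the factorization \<open>\<kappa>\<close> is forced at the
  objects \<open>T x\<close>, where the counit is invertible, and hence everywhere, since \<open>\<gamma> (t x)\<close> is
  invertible and \<open>\<kappa>\<close> is natural; explicitly \<open>\<kappa> x = \<eta> (T x) \<circ> H (\<gamma> (t x))\<^sup>-\<^sup>1\<close>, and this formula does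
  define a factorization. Transformations of functors on a localization are natural as soon as
  they are so on the arrows of the original category (\<open>nat_trans_localizationI\<close>).

  Finally, the two-step functor \<open>Ho(F) \<circ> Ho(Q)\<close> extends \<open>G \<circ> Q\<close> along the localization, so it
  equals \<open>Ho(F \<circ> Q)\<close> by the uniqueness of such extensions (\<open>S_derived_eq\<close>), and the comparison
  isomorphisms come from the uniqueness of Kan extensions (\<open>right_Kan_extension_comparison\<close>).
\<close>

section \<open>Isomorphisms\<close>

context category begin

lemma is_isoE:
  assumes "is_iso C f" "f \<in> hom C x y"
  obtains g where "g \<in> hom C y x" "g \<cdot> f = Ident C x" "f \<cdot> g = Ident C y"
proof -
  obtain g where g: "is_inverse C f g" using assms(1) by (auto simp: is_iso_def)
  with assms(2) show ?thesis by (intro that[of g]) (auto simp: is_inverse_def hom_def)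
qed

lemma iso_cancel_left:
  assumes iso: "is_iso C f" and f: "f \<in> hom C x y"
    and ab: "a \<in> hom C w x" "b \<in> hom C w x" and eq: "f \<cdot> a = f \<cdot> b"
  shows "a = b"
proof -
  obtain g where g: "g \<in> hom C y x" "g \<cdot> f = Ident C x" by (rule is_isoE[OF iso f])
  have "a = g \<cdot> (f \<cdot> a)" using comp_assoc[OF ab(1) f g(1)] ident_left[OF ab(1)] g(2) by simp
  also have "\<dots> = b" using comp_assoc[OF ab(2) f g(1)] ident_left[OF ab(2)] g(2) eq by simp
  finally show ?thesis .
qed

lemma iso_cancel_right:
  assumes iso: "is_iso C f" and f: "f \<in> hom C x y"
    and ab: "a \<in> hom C y z" "b \<in> hom C y z" and eq: "a \<cdot> f = b \<cdot> f"
  shows "a = b"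
proof -
  obtain g where g: "g \<in> hom C y x" "f \<cdot> g = Ident C y" by (rule is_isoE[OF iso f])
  have "a = (a \<cdot> f) \<cdot> g" using comp_assoc[OF g(1) f ab(1)] ident_right[OF ab(1)] g(2) by simp
  also have "\<dots> = b" using comp_assoc[OF g(1) f ab(2)] ident_right[OF ab(2)] g(2) eq by simp
  finally show ?thesis .
qed

lemma inverse_square:
  assumes a: "a \<in> hom C x x'" "is_inverse C a a'" and b: "b \<in> hom C y y'" "is_inverse C b b'"
    and s: "s \<in> hom C x y" and t: "t \<in> hom C x' y'" and sq: "b \<cdot> s = t \<cdot> a"
  shows "b' \<cdot> t = s \<cdot> a'"
proof -
  have a': "a' \<in> hom C x' x" "a \<cdot> a' = Ident C x'" using a by (auto simp: is_inverse_def hom_def)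
  have b': "b' \<in> hom C y' y" "b' \<cdot> b = Ident C y" using b by (auto simp: is_inverse_def hom_def)
  have "t = (t \<cdot> a) \<cdot> a'" using comp_assoc[OF a'(1) a(1) t] ident_right[OF t] a'(2) by simp
  also have "\<dots> = b \<cdot> (s \<cdot> a')" using comp_assoc[OF a'(1) s b(1)] sq by simp
  finally have "b' \<cdot> t = b' \<cdot> (b \<cdot> (s \<cdot> a'))" by simp
  also have "\<dots> = s \<cdot> a'"
    using comp_assoc[OF comp_hom[OF a'(1) s] b(1) b'(1)] ident_left[OF comp_hom[OF a'(1) s]] b'(2)
    by simp
  finally show ?thesis .
qed

end


section \<open>Composites of functors and natural transformations\<close>

lemma fcomp_obj: "x \<in> Obj C \<Longrightarrow> FObj (G \<odot>\<^bsub>C\<^esub> F) x = FObj G (FObj F x)"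
  by (simp add: fcomp_def)

lemma fcomp_arr: "f \<in> Arr C \<Longrightarrow> FArr (G \<odot>\<^bsub>C\<^esub> F) f = FArr G (FArr F f)"
  by (simp add: fcomp_def)

lemma fcomp_assoc:
  assumes "\<And>x. x \<in> Obj C \<Longrightarrow> FObj F x \<in> Obj B" "\<And>f. f \<in> Arr C \<Longrightarrow> FArr F f \<in> Arr B"
  shows "(H \<odot>\<^bsub>B\<^esub> G) \<odot>\<^bsub>C\<^esub> F = H \<odot>\<^bsub>C\<^esub> G \<odot>\<^bsub>C\<^esub> F"
  using assms by (auto simp: fcomp_def)

lemma (in is_functor) map_arr: "f \<in> Arr C \<Longrightarrow> FArr F f \<in> Arr D"
  by (rule hom_arr[OF map_hom[OF arr_hom]])

lemma is_functor_fcomp: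
  assumes "is_functor C D F" "is_functor D E G"
  shows "is_functor C E (G \<odot>\<^bsub>C\<^esub> F)"
proof -
  interpret F: is_functor C D F by fact
  interpret G: is_functor D E G by fact
  show ?thesis
  proof
    show "FObj (G \<odot>\<^bsub>C\<^esub> F) \<in> extensional (Obj C)" "FArr (G \<odot>\<^bsub>C\<^esub> F) \<in> extensional (Arr C)"
      by (auto simp: fcomp_def)
  next
    fix x assume x: "x \<in> Obj C"
    then show "FObj (G \<odot>\<^bsub>C\<^esub> F) x \<in> Obj E" by (simp add: fcomp_obj F.map_obj G.map_obj)
    show "FArr (G \<odot>\<^bsub>C\<^esub> F) (Ident C x) = Ident E (FObj (G \<odot>\<^bsub>C\<^esub> F) x)"
      using x by (simp add: fcomp_obj fcomp_arr hom_arr[OF F.source.ident_hom] F.map_ident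
          G.map_ident F.map_obj)
  next
    fix f x y assume f: "f \<in> hom C x y"
    then show "FArr (G \<odot>\<^bsub>C\<^esub> F) f \<in> hom E (FObj (G \<odot>\<^bsub>C\<^esub> F) x) (FObj (G \<odot>\<^bsub>C\<^esub> F) y)"
      using F.source.hom_obj[OF f] G.map_hom[OF F.map_hom[OF f]]
      by (simp add: fcomp_obj fcomp_arr hom_arr[OF f])
  next
    fix f g x y z assume fg: "f \<in> hom C x y" "g \<in> hom C y z"
    then show "FArr (G \<odot>\<^bsub>C\<^esub> F) (g \<cdot>\<^bsub>C\<^esub> f) = FArr (G \<odot>\<^bsub>C\<^esub> F) g \<cdot>\<^bsub>E\<^esub> FArr (G \<odot>\<^bsub>C\<^esub> F) f"
      using hom_arr[OF F.source.comp_hom[OF fg]] F.map_comp[OF fg]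
        G.map_comp[OF F.map_hom[OF fg(1)] F.map_hom[OF fg(2)]]
      by (simp add: fcomp_arr hom_arr)
  qed
qed

lemma functor_is_iso: "is_functor C D F \<Longrightarrow> is_iso C f \<Longrightarrow> is_iso D (FArr F f)"
  using functor_is_inverse by (fastforce simp: is_iso_def)

lemma nat_transD:
  assumes "nat_trans C D F G t"
  shows "is_functor C D F" "is_functor C D G" "t \<in> extensional (Obj C)"
    and "x \<in> Obj C \<Longrightarrow> t x \<in> hom D (FObj F x) (FObj G x)"
    and "f \<in> hom C x y \<Longrightarrow> FArr G f \<cdot>\<^bsub>D\<^esub> t x = t y \<cdot>\<^bsub>D\<^esub> FArr F f"
  using assms by (auto simp: nat_trans_def)

lemma nat_trans_ident:
  assumes "is_functor C D F"
  shows "nat_trans C D F F (\<lambda>x\<in>Obj C. Ident D (FObj F x))"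
proof -
  interpret is_functor C D F by fact
  have "FArr F f \<cdot>\<^bsub>D\<^esub> Ident D (FObj F x) = Ident D (FObj F y) \<cdot>\<^bsub>D\<^esub> FArr F f"
    if "f \<in> hom C x y" for f x y
    using target.ident_left[OF map_hom[OF that]] target.ident_right[OF map_hom[OF that]] by simp
  then show ?thesis
    using assms source.hom_obj target.ident_hom[OF map_obj] by (auto simp: nat_trans_def)
qed

lemma nat_trans_vcomp:
  assumes s: "nat_trans C D G H s" and t: "nat_trans C D F G t"
  shows "nat_trans C D F H (vcomp C D s t)"
proof -
  interpret F: is_functor C D F using nat_transD(1)[OF t] .
  interpret G: is_functor C D G using nat_transD(1)[OF s] .
  interpret H: is_functor C D H using nat_transD(2)[OF s] .
  show ?thesis
    unfolding nat_trans_def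
  proof (intro conjI ballI allI F.is_functor_axioms H.is_functor_axioms)
    show "vcomp C D s t \<in> extensional (Obj C)" by (simp add: vcomp_def)
  next
    fix x assume x: "x \<in> Obj C"
    then show "vcomp C D s t x \<in> hom D (FObj F x) (FObj H x)"
      using F.target.comp_hom[OF nat_transD(4)[OF t x] nat_transD(4)[OF s x]]
      by (simp add: vcomp_def)
  next
    fix x y f assume f: "f \<in> hom C x y"
    then have x: "x \<in> Obj C" and y: "y \<in> Obj C" using F.source.hom_obj by auto
    note tx = nat_transD(4)[OF t x] and ty = nat_transD(4)[OF t y]
      and sx = nat_transD(4)[OF s x] and sy = nat_transD(4)[OF s y]
    have "FArr H f \<cdot>\<^bsub>D\<^esub> (s x \<cdot>\<^bsub>D\<^esub> t x) = s y \<cdot>\<^bsub>D\<^esub> (FArr G f \<cdot>\<^bsub>D\<^esub> t x)"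
      using F.target.comp_assoc[OF tx sx H.map_hom[OF f]]
        F.target.comp_assoc[OF tx G.map_hom[OF f] sy] nat_transD(5)[OF s f] by simp
    also have "\<dots> = (s y \<cdot>\<^bsub>D\<^esub> t y) \<cdot>\<^bsub>D\<^esub> FArr F f"
      using F.target.comp_assoc[OF F.map_hom[OF f] ty sy] nat_transD(5)[OF t f] by simp
    finally show "FArr H f \<cdot>\<^bsub>D\<^esub> vcomp C D s t x = vcomp C D s t y \<cdot>\<^bsub>D\<^esub> FArr F f"
      using x y by (simp add: vcomp_def)
  qed
qed

lemma nat_trans_whisker:
  assumes P: "is_functor C C' P" and t: "nat_trans C' D F G t"
  shows "nat_trans C D (F \<odot>\<^bsub>C\<^esub> P) (G \<odot>\<^bsub>C\<^esub> P) (whisker C t P)"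
proof -
  interpret P: is_functor C C' P by fact
  have "FArr (G \<odot>\<^bsub>C\<^esub> P) f \<cdot>\<^bsub>D\<^esub> whisker C t P x = whisker C t P y \<cdot>\<^bsub>D\<^esub> FArr (F \<odot>\<^bsub>C\<^esub> P) f"
    if f: "f \<in> hom C x y" for f x y
    using P.source.hom_obj[OF f] nat_transD(5)[OF t P.map_hom[OF f]]
    by (simp add: fcomp_arr hom_arr[OF f] whisker_def)
  then show ?thesis
    using is_functor_fcomp[OF P nat_transD(1)[OF t]] is_functor_fcomp[OF P nat_transD(2)[OF t]]
      nat_transD(4)[OF t P.map_obj]
    by (auto simp: nat_trans_def fcomp_obj whisker_def)
qed

lemma nat_iso_whisker:
  assumes "is_functor C C' P" "nat_iso C' D F G t"
  shows "nat_iso C D (F \<odot>\<^bsub>C\<^esub> P) (G \<odot>\<^bsub>C\<^esub> P) (whisker C t P)"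
  using assms nat_trans_whisker[OF assms(1), of D F G t] is_functor.map_obj[OF assms(1)]
  by (simp add: nat_iso_def whisker_def)


section \<open>Comparison of right Kan extensions\<close>

lemma right_Kan_extensionD:
  assumes "right_Kan_extension C C' D P G R \<epsilon>"
  shows "is_functor C C' P" "is_functor C' D R" "nat_trans C D (R \<odot>\<^bsub>C\<^esub> P) G \<epsilon>"
    and "is_functor C' D H \<Longrightarrow> nat_trans C D (H \<odot>\<^bsub>C\<^esub> P) G \<eta> \<Longrightarrow>
      \<exists>!\<kappa>. nat_trans C' D H R \<kappa> \<and> \<eta> = vcomp C D \<epsilon> (whisker C \<kappa> P)"
  using assms unfolding right_Kan_extension_def by blast+

text \<open>Factorizations through counits compose: this is what makes the two comparison maps between
  Kan extensions mutually inverse.\<close>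

lemma counit_factor_vcomp:
  assumes \<kappa>: "nat_trans C' D R R' \<kappa>" and \<mu>: "nat_trans C' D R' R'' \<mu>"
    and \<epsilon>'': "nat_trans C D (R'' \<odot>\<^bsub>C\<^esub> P) G \<epsilon>''" and P: "is_functor C C' P"
    and "\<epsilon> = vcomp C D \<epsilon>' (whisker C \<kappa> P)" "\<epsilon>' = vcomp C D \<epsilon>'' (whisker C \<mu> P)"
  shows "\<epsilon> = vcomp C D \<epsilon>'' (whisker C (vcomp C' D \<mu> \<kappa>) P)"
proof
  fix x
  interpret P: is_functor C C' P by fact
  interpret D: category D using nat_transD(1)[OF \<kappa>] by (simp add: is_functor_def)
  show "\<epsilon> x = vcomp C D \<epsilon>'' (whisker C (vcomp C' D \<mu> \<kappa>) P) x"
  proof (cases "x \<in> Obj C")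
    case True
    note Px = P.map_obj[OF True]
    show ?thesis
      using D.comp_assoc[OF nat_transD(4)[OF \<kappa> Px] nat_transD(4)[OF \<mu> Px]
          nat_transD(4)[OF \<epsilon>'' True, unfolded fcomp_obj[OF True]]]
      by (simp add: assms(5,6) vcomp_def whisker_def True Px)
  qed (simp add: assms(5) vcomp_def)
qed

text \<open>The identity also factors the counit through itself, and such factorizations are unique.\<close>

lemma right_Kan_extension_endo_eq_ident:
  assumes K: "right_Kan_extension C C' D P G R \<epsilon>"
    and \<kappa>: "nat_trans C' D R R \<kappa>" "\<epsilon> = vcomp C D \<epsilon> (whisker C \<kappa> P)" and x: "x \<in> Obj C'"
  shows "\<kappa> x = Ident D (FObj R x)"
proof -
  note KD = right_Kan_extensionD[OF K]
  let ?i = "\<lambda>x\<in>Obj C'. Ident D (FObj R x)"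
  interpret P: is_functor C C' P by (rule KD(1))
  interpret R: is_functor C' D R by (rule KD(2))
  have "\<epsilon> = vcomp C D \<epsilon> (whisker C ?i P)"
  proof
    fix z
    show "\<epsilon> z = vcomp C D \<epsilon> (whisker C ?i P) z"
    proof (cases "z \<in> Obj C")
      case True
      then show ?thesis
        using R.target.ident_right[OF nat_transD(4)[OF KD(3) True]]
        by (simp add: vcomp_def whisker_def P.map_obj fcomp_obj)
    next
      case False
      then show ?thesis using nat_transD(3)[OF KD(3)] by (simp add: vcomp_def extensional_def)
    qed
  qed
  then have "\<kappa> = ?i" using KD(4)[OF KD(2,3)] \<kappa> nat_trans_ident[OF KD(2)] by blast
  then show ?thesis using x by simp
qed

lemma right_Kan_extension_comparison:
  assumes K: "right_Kan_extension C C' D P G R \<epsilon>" and K': "right_Kan_extension C C' D P G R' \<epsilon>'"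
  shows "\<exists>!\<kappa>. comparison_iso C C' D P R \<epsilon> R' \<epsilon>' \<kappa>"
proof -
  note KD = right_Kan_extensionD[OF K] and KD' = right_Kan_extensionD[OF K']
  obtain \<kappa> where \<kappa>: "nat_trans C' D R R' \<kappa>" "\<epsilon> = vcomp C D \<epsilon>' (whisker C \<kappa> P)"
    using KD'(4)[OF KD(2,3)] by blast
  obtain \<mu> where \<mu>: "nat_trans C' D R' R \<mu>" "\<epsilon>' = vcomp C D \<epsilon> (whisker C \<mu> P)"
    using KD(4)[OF KD'(2,3)] by blast
  have "is_iso D (\<kappa> x)" if x: "x \<in> Obj C'" for x
  proof -
    have "\<mu> x \<cdot>\<^bsub>D\<^esub> \<kappa> x = Ident D (FObj R x)"
      using right_Kan_extension_endo_eq_ident[OF K nat_trans_vcomp[OF \<mu>(1) \<kappa>(1)]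
        counit_factor_vcomp[OF \<kappa>(1) \<mu>(1) KD(3) KD(1) \<kappa>(2) \<mu>(2)] x] x by (simp add: vcomp_def)
    moreover have "\<kappa> x \<cdot>\<^bsub>D\<^esub> \<mu> x = Ident D (FObj R' x)"
      using right_Kan_extension_endo_eq_ident[OF K' nat_trans_vcomp[OF \<kappa>(1) \<mu>(1)]
        counit_factor_vcomp[OF \<mu>(1) \<kappa>(1) KD'(3) KD(1) \<mu>(2) \<kappa>(2)] x] x by (simp add: vcomp_def)
    ultimately show ?thesis
      using nat_transD(4)[OF \<kappa>(1) x] nat_transD(4)[OF \<mu>(1) x]
      by (auto simp: is_iso_def is_inverse_def hom_def)
  qed
  with \<kappa> have "comparison_iso C C' D P R \<epsilon> R' \<epsilon>' \<kappa>" by (simp add: comparison_iso_def nat_iso_def)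
  moreover have "\<kappa>' = \<kappa>" if "comparison_iso C C' D P R \<epsilon> R' \<epsilon>' \<kappa>'" for \<kappa>'
    using KD'(4)[OF KD(2,3)] \<kappa> that by (auto simp: comparison_iso_def nat_iso_def)
  ultimately show ?thesis by blast
qed


section \<open>Functors and transformations on a localization\<close>

text \<open>Induction over the arrows of a localization without reference to zigzags: its
  arrows are generated by the images of the arrows of \<open>C\<close> and the inverses of those in \<open>W\<close>.\<close>

lemma (in category) localization_arr_induct [consumes 1, case_names ident fwd bwd comp]:
  assumes "a \<in> hom (localization C W) x y"
    and ident: "\<And>x. x \<in> Obj C \<Longrightarrow> P x x (Ident (localization C W) x)"
    and fwd: "\<And>x y f. f \<in> hom C x y \<Longrightarrow> P x y (FArr (loc_functor C W) f)"
    and bwd: "\<And>x y w v. w \<in> hom C x y \<Longrightarrow> w \<in> W \<Longrightarrow>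
      is_inverse (localization C W) (FArr (loc_functor C W) w) v \<Longrightarrow> P y x v"
    and comp: "\<And>x y z a b. a \<in> hom (localization C W) x y \<Longrightarrow> b \<in> hom (localization C W) y z \<Longrightarrow>
      P x y a \<Longrightarrow> P y z b \<Longrightarrow> P x z (b \<cdot>\<^bsub>localization C W\<^esub> a)"
  shows "P x y a"
proof -
  have "P x y (zigzag_class C W x s y)" if "zigzag C W x s y" for s
    using that
  proof (induction s arbitrary: x)
    case Nil
    then show ?case using ident[of x] by auto
  next
    case (Cons e s)
    \<comment> \<open>Split off the first step of the zigzag, whatever its direction.\<close>
    have step: "P x y (zigzag_class C W x (e # s) y)"
      if "zigzag C W x [e] z" "zigzag C W z s y" "P x z (zigzag_class C W x [e] z)" for z
      using comp[OF loc_homI[OF that(1)] loc_homI[OF that(2)] that(3) Cons.IH[OF that(2)]]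
        loc_comp[OF that(1,2)] by simp
    show ?case
    proof (cases e)
      case (Fwd f)
      with Cons have f: "f \<in> hom C x (Cod C f)" "zigzag C W (Cod C f) s y" by (auto simp: hom_def)
      show ?thesis
        using step[OF _ f(2)] zigzag_fwd[OF f(1)] fwd[OF f(1)] unfolding Fwd loc_functor_arr[OF f(1)]
        by blast
    next
      case (Bwd w)
      with Cons have w: "w \<in> hom C (Dom C w) x" "w \<in> W" "zigzag C W (Dom C w) s y"
        by (auto simp: hom_def)
      show ?thesis
        using step[OF _ w(3)] zigzag_bwd[OF w(1,2)] bwd[OF w(1,2) loc_bwd_inverse[OF w(1,2)]]
        unfolding Bwd by blast
    qed
  qed
  then show ?thesis using assms(1) by (auto simp: loc_hom)
qed

text \<open>Naturality squares can be pasted, and a square with two opposite invertible sides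
  can be reversed, so naturality spreads from the arrows of \<open>C\<close> to all zigzags.\<close>

lemma nat_trans_localizationI:
  assumes C: "category C"
    and H: "is_functor (localization C W) D H" and K: "is_functor (localization C W) D K"
    and ext: "t \<in> extensional (Obj C)"
    and t: "\<And>x. x \<in> Obj C \<Longrightarrow> t x \<in> hom D (FObj H x) (FObj K x)"
    and nat: "\<And>x y f. f \<in> hom C x y \<Longrightarrow>
      FArr K (FArr (loc_functor C W) f) \<cdot>\<^bsub>D\<^esub> t x = t y \<cdot>\<^bsub>D\<^esub> FArr H (FArr (loc_functor C W) f)"
  shows "nat_trans (localization C W) D H K t"
proof -
  interpret C: category C by fact
  interpret H: is_functor "localization C W" D H by fact
  interpret K: is_functor "localization C W" D K by fact
  interpret P: is_functor C "localization C W" "loc_functor C W"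
    by (rule C.is_functor_loc_functor)
  have "FArr K a \<cdot>\<^bsub>D\<^esub> t x = t y \<cdot>\<^bsub>D\<^esub> FArr H a" if "a \<in> hom (localization C W) x y" for a x y
    using that
  proof (induction rule: C.localization_arr_induct)
    case (ident x)
    then show ?case
      using H.map_ident[of x] K.map_ident[of x] H.target.ident_left[OF t[OF ident]]
        H.target.ident_right[OF t[OF ident]] by simp
  next
    case (fwd x y f)
    then show ?case by (rule nat)
  next
    case (bwd x y w v)
    have xy: "x \<in> Obj C" "y \<in> Obj C" using C.hom_obj[OF bwd(1)] by auto
    have w: "FArr (loc_functor C W) w \<in> hom (localization C W) x y"
      using P.map_hom[OF bwd(1)] xy by (simp add: C.loc_functor_obj)
    show ?case
      by (rule H.target.inverse_square[OF H.map_hom[OF w] functor_is_inverse[OF H bwd(3)]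
          K.map_hom[OF w] functor_is_inverse[OF K bwd(3)] t[OF xy(1)] t[OF xy(2)] nat[OF bwd(1)]])
  next
    case (comp x y z a b)
    have obj: "x \<in> Obj C" "y \<in> Obj C" "z \<in> Obj C"
      using H.source.hom_obj[OF comp(1)] H.source.hom_obj[OF comp(2)] by auto
    have "(FArr K b \<cdot>\<^bsub>D\<^esub> FArr K a) \<cdot>\<^bsub>D\<^esub> t x = FArr K b \<cdot>\<^bsub>D\<^esub> (t y \<cdot>\<^bsub>D\<^esub> FArr H a)"
      using H.target.comp_assoc[OF t[OF obj(1)] K.map_hom[OF comp(1)] K.map_hom[OF comp(2)]]
        comp(3) by simp
    also have "\<dots> = t z \<cdot>\<^bsub>D\<^esub> (FArr H b \<cdot>\<^bsub>D\<^esub> FArr H a)"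
      using H.target.comp_assoc[OF H.map_hom[OF comp(1)] t[OF obj(2)] K.map_hom[OF comp(2)]]
        H.target.comp_assoc[OF H.map_hom[OF comp(1)] H.map_hom[OF comp(2)] t[OF obj(3)]]
        comp(4) by simp
    finally show ?case using H.map_comp[OF comp(1,2)] K.map_comp[OF comp(1,2)] by simp
  qed
  then show ?thesis using H K ext t by (simp add: nat_trans_def)
qed

lemma loc_ext_eqI:
  assumes "is_functor C D G" "\<And>w. w \<in> Arr C \<Longrightarrow> w \<in> W \<Longrightarrow> is_iso D (FArr G w)"
    and "is_functor (localization C W) D H" "H \<odot>\<^bsub>C\<^esub> loc_functor C W = G"
  shows "loc_ext C W D G = H"
  using localization_universal[OF assms(1,2)] loc_ext[OF assms(1,2)] assms(3,4) by blast


section \<open>Cofibrant resolutions\<close>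

text \<open>The common core of the local and the functorial replacement. The lifts \<open>T f\<close> are part of
  the data, and \<open>T\<close> becomes functorial only after composition with a suitable functor.\<close>

locale cofibrant_resolution = model_category M
  for M :: "('o, 'm, 'x) model_scheme" (structure) +
  fixes T :: "('o, 'm, 'o, 'm) fctr" and t :: "'o \<Rightarrow> 'm"
  assumes cofibrant_res: "x \<in> Obj M \<Longrightarrow> cofibrant M (FObj T x)"
    and res_hom: "x \<in> Obj M \<Longrightarrow> t x \<in> hom M (FObj T x) x"
    and res_weq: "x \<in> Obj M \<Longrightarrow> t x \<in> Weq M"
    and lift_hom: "f \<in> hom M x y \<Longrightarrow> FArr T f \<in> hom M (FObj T x) (FObj T y)"
    and lift_square: "f \<in> hom M x y \<Longrightarrow> t y \<cdot> FArr T f = f \<cdot> t x"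
begin

lemma res_obj: "x \<in> Obj M \<Longrightarrow> FObj T x \<in> Obj M"
  using cofibrant_res by (simp add: cofibrant_def)

lemma lift_weq:
  assumes w: "w \<in> hom M x y" "w \<in> Weq M"
  shows "FArr T w \<in> Weq M"
proof -
  have x: "x \<in> Obj M" "y \<in> Obj M" using hom_obj[OF w(1)] by auto
  have "w \<cdot> t x \<in> Weq M" using two_of_three[OF res_hom[OF x(1)] w(1)] w(2) res_weq x by blast
  then have "t y \<cdot> FArr T w \<in> Weq M" by (simp add: lift_square[OF w(1)])
  then show ?thesis
    using two_of_three[OF lift_hom[OF w(1)] res_hom[OF x(2)]] res_weq[OF x(2)] by blast
qed

end

lemma cofibrant_resolution_local_replacement:
  assumes "model_category M" "local_cofibrant_F_replacement M Ct c"
  shows "cofibrant_resolution M Ct c"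
  using assms
  by (auto simp: cofibrant_resolution_def cofibrant_resolution_axioms_def cofibrant_def
      local_cofibrant_F_replacement_def)

lemma cofibrant_resolution_replacement_functor:
  assumes M: "model_category M" and Q: "cofibrant_F_replacement_functor M Q q"
  shows "cofibrant_resolution M Q q"
proof -
  interpret model_category M by fact
  have q: "nat_trans M M Q (incl M) q" using Q by (simp add: cofibrant_F_replacement_functor_def)
  interpret Q: is_functor M M Q by (rule nat_transD(1)[OF q])
  show ?thesis
  proof
    fix x assume x: "x \<in> Obj M"
    show "cofibrant M (FObj Q x)" "q x \<in> Weq M"
      using Q x Q.map_obj by (auto simp: cofibrant_F_replacement_functor_def cofibrant_def)
    show "q x \<in> hom M (FObj Q x) x" using nat_transD(4)[OF q x] x by (simp add: incl_def)
  next
    fix f x y assume f: "f \<in> hom M x y"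
    show "FArr Q f \<in> hom M (FObj Q x) (FObj Q y)" by (rule Q.map_hom[OF f])
    show "q y \<cdot>\<^bsub>M\<^esub> FArr Q f = f \<cdot>\<^bsub>M\<^esub> q x"
      using nat_transD(5)[OF q f] hom_arr[OF f] by (simp add: incl_def)
  qed
qed


section \<open>Derived functors from cofibrant resolutions\<close>

text \<open>The hypothesis on \<open>F\<close>, transferred to the functor \<open>\<gamma> N \<circ> F\<close>, whose target may be any
  category.\<close>

locale cofibrantly_homotopical = model_category M + is_functor M D G
  for M :: "('o, 'm, 'x) model_scheme" (structure)
    and D :: "('p, 'n, 'y) cat_scheme" and G :: "('o, 'm, 'p, 'n) fctr" +
  assumes inverts_cofibrant_weq:
    "w \<in> hom M x y \<Longrightarrow> w \<in> Weq M \<Longrightarrow> cofibrant M x \<Longrightarrow> cofibrant M y \<Longrightarrow> is_iso D (FArr G w)"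
begin

text \<open>Two lifts of one arrow along a weak equivalence become equal under \<open>G\<close>. As \<open>y\<close> and
  \<open>z\<close> may fail to be cofibrant, \<open>w\<close> cannot simply be cancelled after applying \<open>G\<close>, but \<open>Q w\<close> can, for a functorial
  cofibrant replacement \<open>Q\<close>. The resulting equality for \<open>Q a\<close> and \<open>Q b\<close> is transported back by the
  naturality squares of \<open>Q \<Rightarrow> id\<close> at \<open>a\<close> and \<open>b\<close>, since \<open>G\<close> inverts the component at \<open>x\<close>.\<close>

lemma weq_equalized_eq:
  assumes a: "a \<in> hom M x y" and b: "b \<in> hom M x y"
    and x: "cofibrant M x" and w: "w \<in> hom M y z" "w \<in> Weq M" and eq: "w \<cdot> a = w \<cdot> b"
  shows "FArr G a = FArr G b"
proof -
  obtain Q q where Q: "cofibrant_F_replacement_functor M Q q"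
    using factor_cof_trivial_fib cofibrant_F_replacement_functor_of_factorization by blast
  interpret Q: cofibrant_resolution M Q q
    by (rule cofibrant_resolution_replacement_functor[OF model_category_axioms Q])
  interpret Qf: is_functor M M Q using Q by (simp add: cofibrant_F_replacement_functor_def)
  have obj: "x \<in> Obj M" "y \<in> Obj M" "z \<in> Obj M" using hom_obj[OF a] hom_obj[OF w(1)] by auto
  note Qa = Q.lift_hom[OF a] and Qb = Q.lift_hom[OF b] and Qw = Q.lift_hom[OF w(1)]
    and qx = Q.res_hom[OF obj(1)] and qy = Q.res_hom[OF obj(2)]
  \<comment> \<open>Functoriality of \<open>Q\<close> replaces \<open>w\<close> by an arrow between cofibrant objects.\<close>
  have "FArr Q w \<cdot> FArr Q a = FArr Q w \<cdot> FArr Q b"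
    using Qf.map_comp[OF a w(1)] Qf.map_comp[OF b w(1)] eq by simp
  then have "FArr G (FArr Q w) \<cdot>\<^bsub>D\<^esub> FArr G (FArr Q a) = FArr G (FArr Q w) \<cdot>\<^bsub>D\<^esub> FArr G (FArr Q b)"
    using map_comp[OF Qa Qw] map_comp[OF Qb Qw] by simp
  moreover have "is_iso D (FArr G (FArr Q w))"
    using inverts_cofibrant_weq[OF Qw Q.lift_weq[OF w]] Q.cofibrant_res obj by blast
  ultimately have Q_eq: "FArr G (FArr Q a) = FArr G (FArr Q b)"
    using target.iso_cancel_left[OF _ map_hom[OF Qw] map_hom[OF Qa] map_hom[OF Qb]] by blast
  \<comment> \<open>The naturality square of \<open>Q \<Rightarrow> id\<close> recovers \<open>G e\<close> from \<open>G (Q e)\<close>.\<close>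
  have "FArr G e \<cdot>\<^bsub>D\<^esub> FArr G (q x) = FArr G (q y) \<cdot>\<^bsub>D\<^esub> FArr G (FArr Q e)" if e: "e \<in> hom M x y" for e
    using map_comp[OF qx e] map_comp[OF Q.lift_hom[OF e] qy] Q.lift_square[OF e] by simp
  from this[OF a] this[OF b] Q_eq
  have "FArr G a \<cdot>\<^bsub>D\<^esub> FArr G (q x) = FArr G b \<cdot>\<^bsub>D\<^esub> FArr G (q x)" by simp
  moreover have "is_iso D (FArr G (q x))"
    using inverts_cofibrant_weq[OF qx Q.res_weq[OF obj(1)] Q.cofibrant_res[OF obj(1)] x] .
  ultimately show ?thesis
    using target.iso_cancel_right[OF _ map_hom[OF qx] map_hom[OF a] map_hom[OF b]] by blast
qed

end

locale cofibrantly_homotopical_resolved = cofibrantly_homotopical M D G + cofibrant_resolution M T t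
  for M :: "('o, 'm, 'x) model_scheme" (structure)
    and D :: "('p, 'n, 'y) cat_scheme" and G :: "('o, 'm, 'p, 'n) fctr"
    and T :: "('o, 'm, 'o, 'm) fctr" and t :: "'o \<Rightarrow> 'm"
begin

lemma fcomp_resolution_arr: "f \<in> hom M x y \<Longrightarrow> FArr (G \<odot>\<^bsub>M\<^esub> T) f = FArr G (FArr T f)"
  by (simp add: fcomp_arr hom_arr)

text \<open>The lift of an identity and an identity are lifts of the same arrow, and so are the lift of
  a composite and the composite of the lifts; \<open>G\<close> identifies them.\<close>

lemma is_functor_fcomp_resolution: "is_functor M D (G \<odot>\<^bsub>M\<^esub> T)"
proof
  show "FObj (G \<odot>\<^bsub>M\<^esub> T) \<in> extensional (Obj M)" "FArr (G \<odot>\<^bsub>M\<^esub> T) \<in> extensional (Arr M)"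
    by (auto simp: fcomp_def)
next
  fix x assume x: "x \<in> Obj M"
  then show "FObj (G \<odot>\<^bsub>M\<^esub> T) x \<in> Obj D" by (simp add: fcomp_obj map_obj res_obj)
  note i = ident_hom[OF x] and Ti = ident_hom[OF res_obj[OF x]]
  have "t x \<cdot> FArr T (Ident M x) = t x \<cdot> Ident M (FObj T x)"
    using lift_square[OF i] ident_left[OF res_hom[OF x]] ident_right[OF res_hom[OF x]] by simp
  then have "FArr G (FArr T (Ident M x)) = FArr G (Ident M (FObj T x))"
    by (rule weq_equalized_eq[OF lift_hom[OF i] Ti cofibrant_res[OF x]
        res_hom[OF x] res_weq[OF x]])
  then show "FArr (G \<odot>\<^bsub>M\<^esub> T) (Ident M x) = Ident D (FObj (G \<odot>\<^bsub>M\<^esub> T) x)"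
    using x by (simp add: fcomp_resolution_arr[OF i] fcomp_obj map_ident res_obj)
next
  fix f x y assume f: "f \<in> hom M x y"
  then show "FArr (G \<odot>\<^bsub>M\<^esub> T) f \<in> hom D (FObj (G \<odot>\<^bsub>M\<^esub> T) x) (FObj (G \<odot>\<^bsub>M\<^esub> T) y)"
    using hom_obj[OF f] map_hom[OF lift_hom[OF f]] by (simp add: fcomp_resolution_arr fcomp_obj)
next
  fix f g x y z assume f: "f \<in> hom M x y" and g: "g \<in> hom M y z"
  have obj: "x \<in> Obj M" "y \<in> Obj M" "z \<in> Obj M" using hom_obj[OF f] hom_obj[OF g] by auto
  note gf = comp_hom[OF f g] and Tf = lift_hom[OF f] and Tg = lift_hom[OF g]
    and tx = res_hom[OF obj(1)] and ty = res_hom[OF obj(2)] and tz = res_hom[OF obj(3)]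
  have "t z \<cdot> (FArr T g \<cdot> FArr T f) = g \<cdot> (f \<cdot> t x)"
    using comp_assoc[OF Tf Tg tz] comp_assoc[OF Tf ty g] lift_square[OF f] lift_square[OF g] by simp
  then have "t z \<cdot> FArr T (g \<cdot> f) = t z \<cdot> (FArr T g \<cdot> FArr T f)"
    using lift_square[OF gf] comp_assoc[OF tx f g] by simp
  then have "FArr G (FArr T (g \<cdot> f)) = FArr G (FArr T g \<cdot> FArr T f)"
    by (rule weq_equalized_eq[OF lift_hom[OF gf] comp_hom[OF Tf Tg] cofibrant_res[OF obj(1)]
        tz res_weq[OF obj(3)]])
  then show "FArr (G \<odot>\<^bsub>M\<^esub> T) (g \<cdot> f) = FArr (G \<odot>\<^bsub>M\<^esub> T) g \<cdot>\<^bsub>D\<^esub> FArr (G \<odot>\<^bsub>M\<^esub> T) f"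
    using map_comp[OF Tf Tg] by (simp add: fcomp_resolution_arr[OF f] fcomp_resolution_arr[OF g]
        fcomp_resolution_arr[OF gf])
qed

lemma fcomp_resolution_inverts:
  assumes "w \<in> Arr M" "w \<in> Weq M"
  shows "is_iso D (FArr (G \<odot>\<^bsub>M\<^esub> T) w)"
  using inverts_cofibrant_weq[OF lift_hom lift_weq] arr_hom[OF assms(1)] assms
    cofibrant_res[OF dom_obj] cofibrant_res[OF cod_obj]
  by (auto simp: fcomp_arr)

lemma derived_functor:
  "is_functor (Ho M) D (loc_ext M (Weq M) D (G \<odot>\<^bsub>M\<^esub> T))"
  "loc_ext M (Weq M) D (G \<odot>\<^bsub>M\<^esub> T) \<odot>\<^bsub>M\<^esub> \<gamma> M = G \<odot>\<^bsub>M\<^esub> T"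
  unfolding Ho_def ho_functor_def
  by (rule loc_ext[OF is_functor_fcomp_resolution], erule (1) fcomp_resolution_inverts)+

text \<open>The counit \<open>G (t x)\<close> is invertible at cofibrant \<open>x\<close>, and every object of the homotopy
  category is isomorphic to a cofibrant one, its resolution. This determines the factorization of
  any \<open>\<eta>\<close> and also tells how to construct it.\<close>

lemma right_Kan_extension_derived:
  "right_Kan_extension M (Ho M) D (\<gamma> M) G (loc_ext M (Weq M) D (G \<odot>\<^bsub>M\<^esub> T))
     (\<lambda>x\<in>Obj M. FArr G (t x))"
proof -
  let ?R = "loc_ext M (Weq M) D (G \<odot>\<^bsub>M\<^esub> T)" and ?\<epsilon> = "\<lambda>x\<in>Obj M. FArr G (t x)"
  have Obj_Ho: "Obj (Ho M) = Obj M" by (simp add: Ho_def)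
  interpret P: is_functor M "Ho M" "\<gamma> M"
    unfolding Ho_def ho_functor_def by (rule is_functor_loc_functor)
  have P_obj: "FObj (\<gamma> M) x = x" if "x \<in> Obj M" for x
    using loc_functor_obj[OF that] by (simp add: ho_functor_def)
  have P_hom: "FArr (\<gamma> M) f \<in> hom (Ho M) x y" if "f \<in> hom M x y" for f x y
    using P.map_hom[OF that] hom_obj[OF that] by (simp add: P_obj)
  have P_iso: "is_iso (Ho M) (FArr (\<gamma> M) w)" if "w \<in> hom M x y" "w \<in> Weq M" for w x y
    using loc_functor_inverts[OF hom_arr[OF that(1)] that(2)] by (simp add: Ho_def ho_functor_def)
  have R: "is_functor (Ho M) D ?R" and RP: "?R \<odot>\<^bsub>M\<^esub> \<gamma> M = G \<odot>\<^bsub>M\<^esub> T"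
    by (rule derived_functor)+
  have R_obj: "FObj ?R x = FObj G (FObj T x)" if x: "x \<in> Obj M" for x
    using arg_cong[OF RP, of "\<lambda>F. FObj F x"] x by (simp add: fcomp_obj P_obj)
  have R_arr: "FArr ?R (FArr (\<gamma> M) f) = FArr G (FArr T f)" if f: "f \<in> hom M x y" for f x y
    using arg_cong[OF RP, of "\<lambda>F. FArr F f"] hom_arr[OF f] by (simp add: fcomp_arr)
  have Gt: "FArr G (t x) \<in> hom D (FObj G (FObj T x)) (FObj G x)" if x: "x \<in> Obj M" for x
    using map_hom[OF res_hom[OF x]] .
  have Gt_nat: "FArr G f \<cdot>\<^bsub>D\<^esub> FArr G (t x) = FArr G (t y) \<cdot>\<^bsub>D\<^esub> FArr G (FArr T f)"
    if f: "f \<in> hom M x y" for f x y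
    using map_comp[OF res_hom f] map_comp[OF lift_hom[OF f] res_hom] hom_obj[OF f]
      lift_square[OF f] by simp
  have \<epsilon>: "nat_trans M D (?R \<odot>\<^bsub>M\<^esub> \<gamma> M) G ?\<epsilon>"
    unfolding RP using is_functor_fcomp_resolution is_functor_axioms Gt Gt_nat hom_obj
    by (auto simp: nat_trans_def fcomp_obj fcomp_resolution_arr)
  have universal: "\<exists>!\<kappa>. nat_trans (Ho M) D H ?R \<kappa> \<and> \<eta> = vcomp M D ?\<epsilon> (whisker M \<kappa> (\<gamma> M))"
    if H: "is_functor (Ho M) D H" and \<eta>: "nat_trans M D (H \<odot>\<^bsub>M\<^esub> \<gamma> M) G \<eta>" for H \<eta>
  proof -
    interpret H: is_functor "Ho M" D H by fact
    have HP_hom: "FArr H (FArr (\<gamma> M) f) \<in> hom D (FObj H x) (FObj H y)" if "f \<in> hom M x y" for f x y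
      using H.map_hom[OF P_hom[OF that]] .
    have HP_comp: "FArr H (FArr (\<gamma> M) (g \<cdot> f)) = FArr H (FArr (\<gamma> M) g) \<cdot>\<^bsub>D\<^esub> FArr H (FArr (\<gamma> M) f)"
      if "f \<in> hom M x y" "g \<in> hom M y z" for f g x y z
      using P.map_comp[OF that] H.map_comp[OF P_hom[OF that(1)] P_hom[OF that(2)]] by simp
    have \<eta>_hom: "\<eta> x \<in> hom D (FObj H x) (FObj G x)" if x: "x \<in> Obj M" for x
      using nat_transD(4)[OF \<eta> x] x by (simp add: fcomp_obj P_obj)
    have \<eta>_nat: "FArr G f \<cdot>\<^bsub>D\<^esub> \<eta> x = \<eta> y \<cdot>\<^bsub>D\<^esub> FArr H (FArr (\<gamma> M) f)" if f: "f \<in> hom M x y" for f x y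
      using nat_transD(5)[OF \<eta> f] hom_arr[OF f] by (simp add: fcomp_arr)
    let ?Ht = "\<lambda>x. FArr H (FArr (\<gamma> M) (t x))"
    have Ht: "?Ht x \<in> hom D (FObj H (FObj T x)) (FObj H x)" if "x \<in> Obj M" for x
      using HP_hom[OF res_hom[OF that]] .
    have Ht_iso: "is_iso D (?Ht x)" if x: "x \<in> Obj M" for x
      using functor_is_iso[OF H P_iso[OF res_hom[OF x] res_weq[OF x]]] .
    have factor_iff: "\<eta> = vcomp M D ?\<epsilon> (whisker M \<kappa> (\<gamma> M)) \<longleftrightarrow>
        (\<forall>x\<in>Obj M. \<eta> x = FArr G (t x) \<cdot>\<^bsub>D\<^esub> \<kappa> x)" for \<kappa>
      using nat_transD(3)[OF \<eta>] by (auto simp: fun_eq_iff vcomp_def whisker_def P_obj extensional_def)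
    define u where "u x = (SOME v. is_inverse D (?Ht x) v)" for x
    have u_inv: "is_inverse D (?Ht x) (u x)" if "x \<in> Obj M" for x
      unfolding u_def using Ht_iso[OF that] by (auto simp: is_iso_def intro: someI)
    have u_hom: "u x \<in> hom D (FObj H x) (FObj H (FObj T x))" if x: "x \<in> Obj M" for x
      using u_inv[OF x] Ht[OF x] by (auto simp: is_inverse_def hom_def)
    have Ht_u: "?Ht x \<cdot>\<^bsub>D\<^esub> u x = Ident D (FObj H x)" if x: "x \<in> Obj M" for x
      using u_inv[OF x] Ht[OF x] by (auto simp: is_inverse_def hom_def)
    \<comment> \<open>The only choice at \<open>x\<close>: go back along \<open>H (\<gamma> (t x))\<close> to the resolution, whose image
      under \<open>G\<close> is the target of \<open>\<kappa> x\<close>, and apply \<open>\<eta>\<close> there.\<close>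
    define \<kappa> where "\<kappa> = (\<lambda>x\<in>Obj M. \<eta> (FObj T x) \<cdot>\<^bsub>D\<^esub> u x)"
    have \<kappa>_hom: "\<kappa> x \<in> hom D (FObj H x) (FObj ?R x)" if x: "x \<in> Obj M" for x
      using target.comp_hom[OF u_hom[OF x] \<eta>_hom[OF res_obj[OF x]]] x by (simp add: \<kappa>_def R_obj)
    have "FArr ?R (FArr (\<gamma> M) f) \<cdot>\<^bsub>D\<^esub> \<kappa> x = \<kappa> y \<cdot>\<^bsub>D\<^esub> FArr H (FArr (\<gamma> M) f)"
      if f: "f \<in> hom M x y" for f x y
    proof -
      have x: "x \<in> Obj M" and y: "y \<in> Obj M" using hom_obj[OF f] by auto
      note Tf = lift_hom[OF f] and \<eta>x = \<eta>_hom[OF res_obj[OF x]] and \<eta>y = \<eta>_hom[OF res_obj[OF y]]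
      have "FArr H (FArr (\<gamma> M) f) \<cdot>\<^bsub>D\<^esub> ?Ht x = ?Ht y \<cdot>\<^bsub>D\<^esub> FArr H (FArr (\<gamma> M) (FArr T f))"
        using HP_comp[OF res_hom[OF x] f] HP_comp[OF Tf res_hom[OF y]] lift_square[OF f] by simp
      then have u_nat: "u y \<cdot>\<^bsub>D\<^esub> FArr H (FArr (\<gamma> M) f) = FArr H (FArr (\<gamma> M) (FArr T f)) \<cdot>\<^bsub>D\<^esub> u x"
        using target.inverse_square[OF Ht[OF x] u_inv[OF x] Ht[OF y] u_inv[OF y] HP_hom[OF Tf]
            HP_hom[OF f]] by simp
      have "FArr G (FArr T f) \<cdot>\<^bsub>D\<^esub> (\<eta> (FObj T x) \<cdot>\<^bsub>D\<^esub> u x) =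
          \<eta> (FObj T y) \<cdot>\<^bsub>D\<^esub> (FArr H (FArr (\<gamma> M) (FArr T f)) \<cdot>\<^bsub>D\<^esub> u x)"
        using target.comp_assoc[OF u_hom[OF x] \<eta>x map_hom[OF Tf]]
          target.comp_assoc[OF u_hom[OF x] HP_hom[OF Tf] \<eta>y] \<eta>_nat[OF Tf] by simp
      also have "\<dots> = (\<eta> (FObj T y) \<cdot>\<^bsub>D\<^esub> u y) \<cdot>\<^bsub>D\<^esub> FArr H (FArr (\<gamma> M) f)"
        using target.comp_assoc[OF HP_hom[OF f] u_hom[OF y] \<eta>y] u_nat by simp
      finally show ?thesis using x y by (simp add: \<kappa>_def R_arr[OF f])
    qed
    moreover have "\<kappa> \<in> extensional (Obj M)" by (simp add: \<kappa>_def)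
    ultimately have \<kappa>_nat: "nat_trans (Ho M) D H ?R \<kappa>"
      using H R \<kappa>_hom unfolding Ho_def ho_functor_def
      by (intro nat_trans_localizationI[OF category_axioms]) blast+
    have "\<eta> x = FArr G (t x) \<cdot>\<^bsub>D\<^esub> \<kappa> x" if x: "x \<in> Obj M" for x
    proof -
      have "FArr G (t x) \<cdot>\<^bsub>D\<^esub> (\<eta> (FObj T x) \<cdot>\<^bsub>D\<^esub> u x) = \<eta> x \<cdot>\<^bsub>D\<^esub> (?Ht x \<cdot>\<^bsub>D\<^esub> u x)"
        using target.comp_assoc[OF u_hom[OF x] \<eta>_hom[OF res_obj[OF x]] Gt[OF x]]
          target.comp_assoc[OF u_hom[OF x] Ht[OF x] \<eta>_hom[OF x]] \<eta>_nat[OF res_hom[OF x]] by simp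
      then show ?thesis using x target.ident_right[OF \<eta>_hom[OF x]] by (simp add: Ht_u \<kappa>_def)
    qed
    then have factor: "\<eta> = vcomp M D ?\<epsilon> (whisker M \<kappa> (\<gamma> M))" by (simp add: factor_iff)
    have "\<mu> = \<nu>"
      if \<mu>: "nat_trans (Ho M) D H ?R \<mu>" "\<eta> = vcomp M D ?\<epsilon> (whisker M \<mu> (\<gamma> M))"
        and \<nu>: "nat_trans (Ho M) D H ?R \<nu>" "\<eta> = vcomp M D ?\<epsilon> (whisker M \<nu> (\<gamma> M))" for \<mu> \<nu>
    proof (rule extensionalityI[of _ "Obj M"])
      show "\<mu> \<in> extensional (Obj M)" "\<nu> \<in> extensional (Obj M)"
        using nat_transD(3)[OF \<mu>(1)] nat_transD(3)[OF \<nu>(1)] by (simp_all add: Obj_Ho)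
      have hom: "\<mu> x \<in> hom D (FObj H x) (FObj G (FObj T x))"
        "\<nu> x \<in> hom D (FObj H x) (FObj G (FObj T x))" if "x \<in> Obj M" for x
        using nat_transD(4)[OF \<mu>(1)] nat_transD(4)[OF \<nu>(1)] that by (simp_all add: Obj_Ho R_obj)
      fix x assume x: "x \<in> Obj M"
      note Tx = res_obj[OF x]
      \<comment> \<open>At the cofibrant object \<open>T x\<close> the counit is invertible, so both agree there; naturality
        along the isomorphism \<open>\<gamma> (t x)\<close> carries this to \<open>x\<close>.\<close>
      have "FArr G (t (FObj T x)) \<cdot>\<^bsub>D\<^esub> \<mu> (FObj T x) = FArr G (t (FObj T x)) \<cdot>\<^bsub>D\<^esub> \<nu> (FObj T x)"
        using \<mu>(2) \<nu>(2) Tx unfolding factor_iff by metis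
      moreover have "is_iso D (FArr G (t (FObj T x)))"
        using inverts_cofibrant_weq[OF res_hom[OF Tx] res_weq[OF Tx] cofibrant_res[OF Tx]
            cofibrant_res[OF x]] .
      ultimately have "\<mu> (FObj T x) = \<nu> (FObj T x)"
        using target.iso_cancel_left[OF _ Gt[OF Tx] hom(1)[OF Tx] hom(2)[OF Tx]] by blast
      then have "\<mu> x \<cdot>\<^bsub>D\<^esub> ?Ht x = \<nu> x \<cdot>\<^bsub>D\<^esub> ?Ht x"
        using nat_transD(5)[OF \<mu>(1) P_hom[OF res_hom[OF x]]]
          nat_transD(5)[OF \<nu>(1) P_hom[OF res_hom[OF x]]] by simp
      then show "\<mu> x = \<nu> x"
        using target.iso_cancel_right[OF Ht_iso[OF x] Ht[OF x] hom(1)[OF x] hom(2)[OF x]] by blast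
    qed
    with \<kappa>_nat factor show ?thesis by blast
  qed
  show ?thesis
    unfolding right_Kan_extension_def
    using P.is_functor_axioms is_functor_axioms R \<epsilon> universal by blast
qed

end


section \<open>Derived functors through the homotopy category of cofibrant objects\<close>

lemma full_subcat_simps [simp]:
  "Obj (full_subcat C S) = Obj C \<inter> S"
  "Arr (full_subcat C S) = {f \<in> Arr C. Dom C f \<in> S \<and> Cod C f \<in> S}"
  "Ident (full_subcat C S) = Ident C" "Comp (full_subcat C S) = Comp C"
  by (simp_all add: full_subcat_def)

lemma full_subcat_hom:
  "f \<in> hom (full_subcat C S) x y \<longleftrightarrow> f \<in> hom C x y \<and> x \<in> S \<and> y \<in> S"
  by (auto simp: hom_def full_subcat_def)

lemma (in category) category_full_subcat: "category (full_subcat C S)"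
proof
  fix f assume "f \<in> Arr (full_subcat C S)"
  then show "Dom (full_subcat C S) f \<in> Obj (full_subcat C S)"
    "Cod (full_subcat C S) f \<in> Obj (full_subcat C S)"
    using dom_obj cod_obj by (auto simp: full_subcat_def)
qed (auto simp: full_subcat_hom ident_hom ident_left ident_right intro: comp_hom comp_assoc)

lemma (in category) is_functor_incl_full_subcat:
  "is_functor (full_subcat C S) C (incl (full_subcat C S))"
proof -
  interpret S: category "full_subcat C S" by (rule category_full_subcat)
  have obj: "FObj (incl (full_subcat C S)) x = x" if "x \<in> Obj (full_subcat C S)" for x
    using that unfolding incl_def by simp
  have arr: "FArr (incl (full_subcat C S)) f = f" if "f \<in> hom (full_subcat C S) x y" for f x y
    using hom_arr[OF that] unfolding incl_def by simp
  show ?thesis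
  proof
    show "FObj (incl (full_subcat C S)) \<in> extensional (Obj (full_subcat C S))"
      "FArr (incl (full_subcat C S)) \<in> extensional (Arr (full_subcat C S))"
      by (auto simp: incl_def)
  next
    fix x assume x: "x \<in> Obj (full_subcat C S)"
    then show "FObj (incl (full_subcat C S)) x \<in> Obj C" unfolding obj[OF x] by simp
    show "FArr (incl (full_subcat C S)) (Ident (full_subcat C S) x) =
        Ident C (FObj (incl (full_subcat C S)) x)"
      unfolding obj[OF x] arr[OF S.ident_hom[OF x]] by simp
  next
    fix f x y assume f: "f \<in> hom (full_subcat C S) x y"
    show "FArr (incl (full_subcat C S)) f \<in>
        hom C (FObj (incl (full_subcat C S)) x) (FObj (incl (full_subcat C S)) y)"
      using f S.hom_obj[OF f] unfolding arr[OF f] full_subcat_hom by (simp add: obj)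
  next
    fix f g x y z assume fg: "f \<in> hom (full_subcat C S) x y" "g \<in> hom (full_subcat C S) y z"
    show "FArr (incl (full_subcat C S)) (g \<cdot>\<^bsub>full_subcat C S\<^esub> f) =
        FArr (incl (full_subcat C S)) g \<cdot> FArr (incl (full_subcat C S)) f"
      unfolding arr[OF fg(1)] arr[OF fg(2)] arr[OF S.comp_hom[OF fg]] by simp
  qed
qed

lemma is_functor_into_full_subcat:
  assumes "is_functor B C F" and S: "\<And>x. x \<in> Obj B \<Longrightarrow> FObj F x \<in> S"
  shows "is_functor B (full_subcat C S) F"
proof -
  interpret F: is_functor B C F by fact
  interpret S: category "full_subcat C S" by (rule F.target.category_full_subcat)
  show ?thesis
  proof
    fix f x y assume f: "f \<in> hom B x y"
    then show "FArr F f \<in> hom (full_subcat C S) (FObj F x) (FObj F y)"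
      using F.map_hom[OF f] F.source.hom_obj[OF f] S by (simp add: full_subcat_hom)
  qed (simp_all add: F.obj_ext F.arr_ext F.map_obj F.map_ident F.map_comp S)
qed

context cofibrantly_homotopical_resolved begin

text \<open>Both sides restrict along \<open>\<gamma> M\<close> to \<open>G \<circ> T\<close>: the resolution takes values in cofibrant
  objects, so passing through \<open>Ho_c M\<close> and including these objects in \<open>M\<close> again changes
  nothing.\<close>

lemma S_derived_eq:
  assumes T: "is_functor M M T"
  shows "loc_ext (cofibrant_subcat M) (weq_cofibrant M) D
      (G \<odot>\<^bsub>cofibrant_subcat M\<^esub> incl (cofibrant_subcat M))
    \<odot>\<^bsub>Ho M\<^esub> loc_ext M (Weq M) (Ho_c M) (\<gamma>\<^sub>c M \<odot>\<^bsub>M\<^esub> T) = loc_ext M (Weq M) D (G \<odot>\<^bsub>M\<^esub> T)"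
proof -
  let ?c = "cofibrant_subcat M"
  have T_c: "is_functor M ?c T"
    using is_functor_into_full_subcat[OF T] cofibrant_res by (simp add: cofibrant_subcat_def)
  interpret T: is_functor M ?c T by (rule T_c)
  have incl: "is_functor ?c M (incl ?c)"
    unfolding cofibrant_subcat_def by (rule is_functor_incl_full_subcat)
  have G_c: "is_functor ?c D (G \<odot>\<^bsub>?c\<^esub> incl ?c)" by (rule is_functor_fcomp[OF incl is_functor_axioms])
  have G_iso: "is_iso D (FArr (G \<odot>\<^bsub>?c\<^esub> incl ?c) w)" if "w \<in> Arr ?c" "w \<in> weq_cofibrant M" for w
  proof -
    have "FArr (G \<odot>\<^bsub>?c\<^esub> incl ?c) w = FArr G w" using that(1) by (simp add: fcomp_arr incl_def)
    then show ?thesis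
      using inverts_cofibrant_weq[of w "Dom M w" "Cod M w"] that
      by (auto simp: weq_cofibrant_def cofibrant_subcat_def hom_def)
  qed
  have \<gamma>c: "is_functor ?c (Ho_c M) (\<gamma>\<^sub>c M)"
    unfolding Ho_c_def ho_functor_c_def by (rule T.target.is_functor_loc_functor)
  have \<gamma>cT: "is_functor M (Ho_c M) (\<gamma>\<^sub>c M \<odot>\<^bsub>M\<^esub> T)" by (rule is_functor_fcomp[OF T_c \<gamma>c])
  have T_iso: "is_iso (Ho_c M) (FArr (\<gamma>\<^sub>c M \<odot>\<^bsub>M\<^esub> T) w)" if w: "w \<in> Arr M" "w \<in> Weq M" for w
    using T.target.loc_functor_inverts[OF T.map_arr[OF w(1)], of "weq_cofibrant M"]
      lift_weq[OF arr_hom[OF w(1)] w(2)] T.map_arr[OF w(1)] w(1)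
    by (simp add: fcomp_arr Ho_c_def ho_functor_c_def weq_cofibrant_def)
  let ?HoG = "loc_ext ?c (weq_cofibrant M) D (G \<odot>\<^bsub>?c\<^esub> incl ?c)"
  let ?HoT = "loc_ext M (Weq M) (Ho_c M) (\<gamma>\<^sub>c M \<odot>\<^bsub>M\<^esub> T)"
  have HoG: "is_functor (Ho_c M) D ?HoG" "?HoG \<odot>\<^bsub>?c\<^esub> \<gamma>\<^sub>c M = G \<odot>\<^bsub>?c\<^esub> incl ?c"
    unfolding Ho_c_def ho_functor_c_def by (rule loc_ext[OF G_c], erule (1) G_iso)+
  have HoT: "is_functor (Ho M) (Ho_c M) ?HoT" "?HoT \<odot>\<^bsub>M\<^esub> loc_functor M (Weq M) = \<gamma>\<^sub>c M \<odot>\<^bsub>M\<^esub> T"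
    unfolding Ho_def by (rule loc_ext[OF \<gamma>cT], erule (1) T_iso)+
  interpret P: is_functor M "Ho M" "loc_functor M (Weq M)"
    unfolding Ho_def by (rule is_functor_loc_functor)
  have "is_functor (Ho M) D (?HoG \<odot>\<^bsub>Ho M\<^esub> ?HoT)"
    by (rule is_functor_fcomp[OF HoT(1) HoG(1)])
  moreover have "(?HoG \<odot>\<^bsub>Ho M\<^esub> ?HoT) \<odot>\<^bsub>M\<^esub> loc_functor M (Weq M) = G \<odot>\<^bsub>M\<^esub> T"
  proof -
    have "(?HoG \<odot>\<^bsub>Ho M\<^esub> ?HoT) \<odot>\<^bsub>M\<^esub> loc_functor M (Weq M) = ?HoG \<odot>\<^bsub>M\<^esub> \<gamma>\<^sub>c M \<odot>\<^bsub>M\<^esub> T"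
      using HoT(2) by (simp add: fcomp_assoc[OF P.map_obj P.map_arr])
    also have "\<dots> = (?HoG \<odot>\<^bsub>?c\<^esub> \<gamma>\<^sub>c M) \<odot>\<^bsub>M\<^esub> T"
      by (rule fcomp_assoc[OF T.map_obj T.map_arr, symmetric])
    also have "\<dots> = G \<odot>\<^bsub>M\<^esub> incl ?c \<odot>\<^bsub>M\<^esub> T"
      using HoG(2) by (simp add: fcomp_assoc[OF T.map_obj T.map_arr])
    also have "\<dots> = G \<odot>\<^bsub>M\<^esub> T"
      using T.map_obj T.map_arr by (auto simp: fcomp_def incl_def)
    finally show ?thesis .
  qed
  ultimately show ?thesis
    using loc_ext_eqI[OF is_functor_fcomp_resolution fcomp_resolution_inverts] by (simp add: Ho_def)
qed

end


section \<open>The comparison theorem\<close>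

theorem theorem5:
  fixes M :: "('o, 'm) model" and N :: "('p, 'n) model"
    and F :: "('o, 'm, 'p, 'n) fctr"
    and Ct Q :: "('o, 'm, 'o, 'm) fctr" and c q :: "'o \<Rightarrow> 'm"
  assumes "model_category M" and "model_category N"
    and "is_functor M N F"
    and "\<And>f. f \<in> Weq M \<Longrightarrow> cofibrant M (Dom M f) \<Longrightarrow> cofibrant M (Cod M f) \<Longrightarrow>
      FArr F f \<in> Weq N"
    and "local_cofibrant_F_replacement M Ct c"
    and "cofibrant_F_replacement_functor M Q q"
  shows "\<exists>\<epsilon>C \<epsilon>Q.
      K_derived_functor M N F (Ho_ext M N (F \<odot>\<^bsub>M\<^esub> Ct)) \<epsilon>C \<and>
      K_derived_functor M N F (S_derived_functor M N Q F) \<epsilon>Q \<and>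
      S_derived_functor M N Q F = Ho_ext M N (F \<odot>\<^bsub>M\<^esub> Q) \<and>
      Ho_ext M N (F \<odot>\<^bsub>M\<^esub> Ct) \<odot>\<^bsub>M\<^esub> \<gamma> M = \<gamma> N \<odot>\<^bsub>M\<^esub> F \<odot>\<^bsub>M\<^esub> Ct \<and>
      S_derived_functor M N Q F \<odot>\<^bsub>M\<^esub> \<gamma> M = \<gamma> N \<odot>\<^bsub>M\<^esub> F \<odot>\<^bsub>M\<^esub> Q \<and>
      (\<forall>L \<epsilon>. K_derived_functor M N F L \<epsilon> \<longrightarrow>
        (\<exists>!\<kappa>. comparison_iso M (Ho M) (Ho N) (\<gamma> M)
                L \<epsilon> (Ho_ext M N (F \<odot>\<^bsub>M\<^esub> Ct)) \<epsilon>C \<kappa>) \<and>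
        (\<exists>!\<kappa>. comparison_iso M (Ho M) (Ho N) (\<gamma> M)
                L \<epsilon> (S_derived_functor M N Q F) \<epsilon>Q \<kappa>) \<and>
        (\<forall>\<kappa>. comparison_iso M (Ho M) (Ho N) (\<gamma> M)
                L \<epsilon> (Ho_ext M N (F \<odot>\<^bsub>M\<^esub> Ct)) \<epsilon>C \<kappa> \<longrightarrow>
              nat_iso M (Ho N) (L \<odot>\<^bsub>M\<^esub> \<gamma> M) (\<gamma> N \<odot>\<^bsub>M\<^esub> F \<odot>\<^bsub>M\<^esub> Ct)
                (whisker M \<kappa> (\<gamma> M))) \<and>
        (\<forall>\<kappa>. comparison_iso M (Ho M) (Ho N) (\<gamma> M)
                L \<epsilon> (S_derived_functor M N Q F) \<epsilon>Q \<kappa> \<longrightarrow>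
              nat_iso M (Ho N) (L \<odot>\<^bsub>M\<^esub> \<gamma> M) (\<gamma> N \<odot>\<^bsub>M\<^esub> F \<odot>\<^bsub>M\<^esub> Q)
                (whisker M \<kappa> (\<gamma> M))))"
proof -
  interpret M: model_category M by fact
  interpret N: model_category N by fact
  interpret F: is_functor M N F by fact
  let ?c = "cofibrant_subcat M" and ?G = "\<gamma> N \<odot>\<^bsub>M\<^esub> F"
  have \<gamma>N: "is_functor N (Ho N) (\<gamma> N)"
    unfolding Ho_def ho_functor_def by (rule N.is_functor_loc_functor)
  have \<gamma>M: "is_functor M (Ho M) (\<gamma> M)"
    unfolding Ho_def ho_functor_def by (rule M.is_functor_loc_functor)
  have G: "cofibrantly_homotopical M (Ho N) ?G"
  proof (intro cofibrantly_homotopical.intro cofibrantly_homotopical_axioms.intro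
      is_functor_fcomp[OF assms(3) \<gamma>N] M.model_category_axioms)
    fix w x y assume w: "w \<in> hom M x y" "w \<in> Weq M" "cofibrant M x" "cofibrant M y"
    then have "FArr F w \<in> Weq N" using assms(4)[of w] by (auto simp: hom_def)
    then show "is_iso (Ho N) (FArr ?G w)"
      using N.loc_functor_inverts[OF F.map_arr[OF hom_arr[OF w(1)]]]
      by (simp add: fcomp_arr[OF hom_arr[OF w(1)]] Ho_def ho_functor_def)
  qed
  interpret C: cofibrantly_homotopical_resolved M "Ho N" ?G Ct c
    by (intro cofibrantly_homotopical_resolved.intro G
        cofibrant_resolution_local_replacement[OF assms(1,5)])
  interpret Q: cofibrantly_homotopical_resolved M "Ho N" ?G Q q
    by (intro cofibrantly_homotopical_resolved.intro G
        cofibrant_resolution_replacement_functor[OF assms(1,6)])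
  have GC: "?G \<odot>\<^bsub>M\<^esub> Ct = \<gamma> N \<odot>\<^bsub>M\<^esub> F \<odot>\<^bsub>M\<^esub> Ct"
    by (rule fcomp_assoc) (auto intro: C.res_obj hom_arr[OF C.lift_hom[OF arr_hom]])
  have GQ: "?G \<odot>\<^bsub>M\<^esub> Q = \<gamma> N \<odot>\<^bsub>M\<^esub> F \<odot>\<^bsub>M\<^esub> Q"
    by (rule fcomp_assoc) (auto intro: Q.res_obj hom_arr[OF Q.lift_hom[OF arr_hom]])
  let ?LC = "Ho_ext M N (F \<odot>\<^bsub>M\<^esub> Ct)" and ?LQ = "Ho_ext M N (F \<odot>\<^bsub>M\<^esub> Q)"
  let ?\<epsilon>C = "\<lambda>x\<in>Obj M. FArr ?G (c x)" and ?\<epsilon>Q = "\<lambda>x\<in>Obj M. FArr ?G (q x)"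
  have KC: "K_derived_functor M N F ?LC ?\<epsilon>C"
    using C.right_Kan_extension_derived by (simp add: K_derived_functor_def Ho_ext_def GC)
  have KQ: "K_derived_functor M N F ?LQ ?\<epsilon>Q"
    using Q.right_Kan_extension_derived by (simp add: K_derived_functor_def Ho_ext_def GQ)
  have LC: "?LC \<odot>\<^bsub>M\<^esub> \<gamma> M = \<gamma> N \<odot>\<^bsub>M\<^esub> F \<odot>\<^bsub>M\<^esub> Ct"
    using C.derived_functor(2) by (simp add: Ho_ext_def ho_functor_def[of M] GC)
  have LQ: "?LQ \<odot>\<^bsub>M\<^esub> \<gamma> M = \<gamma> N \<odot>\<^bsub>M\<^esub> F \<odot>\<^bsub>M\<^esub> Q"
    using Q.derived_functor(2) by (simp add: Ho_ext_def ho_functor_def[of M] GQ)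
  have S: "S_derived_functor M N Q F = ?LQ"
  proof -
    interpret i: is_functor ?c M "incl ?c"
      unfolding cofibrant_subcat_def by (rule M.is_functor_incl_full_subcat)
    have "?G \<odot>\<^bsub>?c\<^esub> incl ?c = \<gamma> N \<odot>\<^bsub>?c\<^esub> F \<odot>\<^bsub>?c\<^esub> incl ?c"
      by (rule fcomp_assoc[OF i.map_obj i.map_arr])
    moreover have "is_functor M M Q"
      using assms(6) by (simp add: cofibrant_F_replacement_functor_def)
    ultimately show ?thesis
      using Q.S_derived_eq by (simp add: S_derived_functor_def Ho_ext_def GQ)
  qed
  have compare: "\<exists>!\<kappa>. comparison_iso M (Ho M) (Ho N) (\<gamma> M) L \<epsilon> L' \<epsilon>' \<kappa>"
    if "K_derived_functor M N F L \<epsilon>" "K_derived_functor M N F L' \<epsilon>'" for L \<epsilon> L' \<epsilon>'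
    using right_Kan_extension_comparison that unfolding K_derived_functor_def by blast
  have whisker: "nat_iso M (Ho N) (L \<odot>\<^bsub>M\<^esub> \<gamma> M) (L' \<odot>\<^bsub>M\<^esub> \<gamma> M) (whisker M \<kappa> (\<gamma> M))"
    if "comparison_iso M (Ho M) (Ho N) (\<gamma> M) L \<epsilon> L' \<epsilon>' \<kappa>" for L \<epsilon> L' \<epsilon>' \<kappa>
    using nat_iso_whisker[OF \<gamma>M, of "Ho N" L L' \<kappa>] that by (simp add: comparison_iso_def)
  show ?thesis
    unfolding S
  proof (rule exI[of _ ?\<epsilon>C], rule exI[of _ ?\<epsilon>Q], intro conjI allI impI)
    fix L \<epsilon> assume K: "K_derived_functor M N F L \<epsilon>"
    show "\<exists>!\<kappa>. comparison_iso M (Ho M) (Ho N) (\<gamma> M) L \<epsilon> ?LC ?\<epsilon>C \<kappa>"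
      by (rule compare[OF K KC])
    show "\<exists>!\<kappa>. comparison_iso M (Ho M) (Ho N) (\<gamma> M) L \<epsilon> ?LQ ?\<epsilon>Q \<kappa>"
      by (rule compare[OF K KQ])
  next
    fix L \<epsilon> \<kappa> assume "comparison_iso M (Ho M) (Ho N) (\<gamma> M) L \<epsilon> ?LC ?\<epsilon>C \<kappa>"
    then show "nat_iso M (Ho N) (L \<odot>\<^bsub>M\<^esub> \<gamma> M) (\<gamma> N \<odot>\<^bsub>M\<^esub> F \<odot>\<^bsub>M\<^esub> Ct) (whisker M \<kappa> (\<gamma> M))"
      unfolding LC[symmetric] by (rule whisker)
  next
    fix L \<epsilon> \<kappa> assume "comparison_iso M (Ho M) (Ho N) (\<gamma> M) L \<epsilon> ?LQ ?\<epsilon>Q \<kappa>"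
    then show "nat_iso M (Ho N) (L \<odot>\<^bsub>M\<^esub> \<gamma> M) (\<gamma> N \<odot>\<^bsub>M\<^esub> F \<odot>\<^bsub>M\<^esub> Q) (whisker M \<kappa> (\<gamma> M))"
      unfolding LQ[symmetric] by (rule whisker)
  qed (simp_all add: KC KQ LC LQ)
qed

end
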